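(* Let $\bar t>0$ and let $T:L^2(-\pi,\pi)\to L^1(-\pi,\pi)$ be the forward operator of the periodic backwards heat equation, $$(Tf)(x)=\sum_{n\in\mathbb Z}\exp(-n^2\bar t)\,\hat f(n)\exp(\mathrm i nx).$$ Suppose $f^\dagger\in H^p(-\pi,\pi)$ (periodic Sobolev space) with some $p>0$, and put $g^\dagger=Tf^\dagger$. For data $g^{\rm obs}=g^\dagger+\xi$ with $\xi\in L^1(-\pi,\pi)$ let $$\hat f_\alpha\in\operatorname*{argmin}_{f\in L^2(-\pi,\pi)}\Big[\tfrac1\alpha\|Tf-g^{\rm obs}\|_{L^1(-\pi,\pi)}+\|f\|_{L^2(-\pi,\pi)}^2\Big].$$ Suppose that $\alpha=\alpha(\eta,\epsilon)$ is chosen such that, for a fixed constant $C_{\rm e}>0$, $$\sqrt{\frac{2\epsilon}{\alpha}}+\frac{2\eta\,\gamma(2\eta)}{\alpha}\le C_{\rm e}\qquad\text{in the limit }\eta,\epsilon,\alpha\searrow0,$$ with $\gamma$ as in the context. Then there exist $\eta_0>0$ and a constant $C=C(\bar t,T,f^\dagger)$ (for fixed $C_{\rm e}$) such that for any noise function $\xi\in L^1(-\pi,\pi)$ satisfying $$\exists\ \mathbb P\subset(-\pi,\pi)\text{ Borel}:\quad\|\xi\|_{L^1((-\pi,\pi)\setminus\mathbb P)}\le\epsilon,\quad|\mathbb P|\le\eta$$ with $0<\eta\le\eta_0$, $\epsilon\ge0$, one has $$\|\hat f_\alpha-f^\dagger\|_{L^2}^2\le C\Big(\frac\epsilon\alpha+\frac{\eta^2}{\alpha^2}\exp\Big(-\frac{\pi^2}{8\eta^2}\bar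 t\Big)+(-\ln\alpha)^{-p}\Big)(1+o(1)),$$ $$\|T\hat f_\alpha-g^\dagger\|_{L^1}\le C\Big(\epsilon+\frac{\eta^2}{\alpha}\exp\Big(-\frac{\pi^2}{8\eta^2}\bar t\Big)+\alpha(-\ln\alpha)^{-p}\Big)(1+o(1))$$ as $\eta,\epsilon,\alpha\searrow0$. Moreover, the parameter $\alpha=\bar\alpha(\epsilon,\eta)$ can be chosen such that, as $\epsilon,\eta\searrow0$, $$\|\hat f_{\bar\alpha}-f^\dagger\|_{L^2}^2=\mathcal O\big(\max\{(-\ln\epsilon)^{-p},\eta^{2p}\}\big),$$ $$\|T\hat f_{\bar\alpha}-g^\dagger\|_{L^1}=\mathcal O\Big(\max\Big\{\epsilon,\exp\Big(-\frac{\pi^2}{16\eta^2}\bar t\Big)\eta^{2p+1}\Big\}\Big).$$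
   Context: $\hat f(n)=\frac1{2\pi}\int_{-\pi}^{\pi}f(x)e^{-\mathrm inx}\,\mathrm dx$ are the Fourier coefficients. $H^p(-\pi,\pi)$ denotes the $2\pi$-periodic Sobolev space of $f\in L^2(-\pi,\pi)$ with $\sum_{n}(1+n^2)^p|\hat f(n)|^2<\infty$. The function $\gamma$ is $$\gamma(\delta)=\frac{8\max\{1,\bar t^{-1/2}\}}{\exp(3\bar t)-1}\exp\Big(-\Big\lfloor\frac\pi\delta-\frac12\Big\rfloor^2\bar t\Big)$$ for sufficiently small $\delta>0$. Convention: $(-\ln 0)^{-p}=0$. The estimates and the $\mathcal O$-bounds are uniform over all noise functions $\xi$ satisfying the noise condition with the given $\epsilon,\eta$. *)

theory Defs
  imports "HOL-Analysis.Analysis" "HOL-Library.Landau_Symbols"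
begin

text \<open>
  Functions on the open interval from -pi to pi are total functions on the reals, of which only
  the restriction to the interval matters; elements of Lebesgue spaces are represented by functions
  rather than by classes modulo null sets. Functions are complex-valued.
\<close>

definition per :: "real set" where
  "per = {-pi<..<pi}"

definition L1 :: "(real \<Rightarrow> complex) set" where
  "L1 = {g. integrable (lebesgue_on per) g}"

definition L1_norm_on :: "real set \<Rightarrow> (real \<Rightarrow> complex) \<Rightarrow> real" where
  "L1_norm_on A g = (LINT x|lebesgue_on A. norm (g x))"

abbreviation L1_norm :: "(real \<Rightarrow> complex) \<Rightarrow> real" where
  "L1_norm \<equiv> L1_norm_on per"

definition L2 :: "(real \<Rightarrow> complex) set" where
  "L2 = {f \<in> borel_measurable (lebesgue_on per). integrable (lebesgue_on per) (\<lambda>x. (norm (f x))\<^sup>2)}"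

definition L2_norm :: "(real \<Rightarrow> complex) \<Rightarrow> real" where
  "L2_norm f = sqrt (LINT x|lebesgue_on per. (norm (f x))\<^sup>2)"

definition fourier_coeff :: "(real \<Rightarrow> complex) \<Rightarrow> int \<Rightarrow> complex" where
  "fourier_coeff f n =
     1 / (2 * of_real pi) * (LINT x|lebesgue_on per. f x * exp (- (\<i> * of_int n * of_real x)))"

definition sobolev :: "real \<Rightarrow> (real \<Rightarrow> complex) set" where
  "sobolev p = {f \<in> L2.
     (\<lambda>n::int. (1 + (of_int n)\<^sup>2) powr p * (norm (fourier_coeff f n))\<^sup>2) summable_on UNIV}"

text \<open>The parameter \<open>t\<close> is the final time. For square integrable \<open>f\<close> the series converges absolutely.\<close>

definition heat_op :: "real \<Rightarrow> (real \<Rightarrow> complex) \<Rightarrow> real \<Rightarrow> complex" where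
  "heat_op t f x =
     (\<Sum>\<^sub>\<infinity>n::int\<in>UNIV. of_real (exp (- (of_int n)\<^sup>2 * t)) * fourier_coeff f n * exp (\<i> * of_int n * of_real x))"

definition tikhonov :: "real \<Rightarrow> real \<Rightarrow> (real \<Rightarrow> complex) \<Rightarrow> (real \<Rightarrow> complex) \<Rightarrow> real" where
  "tikhonov t \<alpha> gobs f = 1 / \<alpha> * L1_norm (\<lambda>x. heat_op t f x - gobs x) + (L2_norm f)\<^sup>2"

definition tikhonov_minimizer :: "real \<Rightarrow> real \<Rightarrow> (real \<Rightarrow> complex) \<Rightarrow> (real \<Rightarrow> complex) \<Rightarrow> bool" where
  "tikhonov_minimizer t \<alpha> gobs f \<longleftrightarrow> is_arg_min (tikhonov t \<alpha> gobs) (\<lambda>h. h \<in> L2) f"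

definition impulsive_noise :: "real \<Rightarrow> real \<Rightarrow> (real \<Rightarrow> complex) \<Rightarrow> bool" where
  "impulsive_noise \<epsilon> \<eta> \<xi> \<longleftrightarrow>
     (\<exists>P\<in>sets borel. P \<subseteq> per \<and> L1_norm_on (per - P) \<xi> \<le> \<epsilon> \<and> measure lborel P \<le> \<eta>)"

definition gam :: "real \<Rightarrow> real \<Rightarrow> real" where
  "gam t \<delta> = 8 * max 1 (t powr (- 1 / 2)) / (exp (3 * t) - 1)
     * exp (- (of_int \<lfloor>pi / \<delta> - 1 / 2\<rfloor>)\<^sup>2 * t)"

definition admissible :: "real \<Rightarrow> real \<Rightarrow> real \<Rightarrow> real \<Rightarrow> real \<Rightarrow> bool" where
  "admissible t Ce \<eta> \<epsilon> \<alpha> \<longleftrightarrow> sqrt (2 * \<epsilon> / \<alpha>) + 2 * \<eta> * gam t (2 * \<eta>) / \<alpha> \<le> Ce"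

text \<open>
  The logarithmic rate, to be used for \<open>0 \<le> s < 1\<close> only; its value at zero is the usual convention.
\<close>

definition log_rate :: "real \<Rightarrow> real \<Rightarrow> real" where
  "log_rate p s = (if s = 0 then 0 else (- ln s) powr (- p))"

end

theory Submission
  imports Defs "HOL-Real_Asymp.Real_Asymp"
begin

text \<open>
  Put \<open>h = f - fdag\<close>. Minimality of \<open>f\<close> bounds \<open>\<alpha> (\<parallel>f\<parallel>\<^sup>2 - \<parallel>fdag\<parallel>\<^sup>2) + \<parallel>T h\<parallel>\<^sub>1\<close> by \<open>2 \<epsilon>\<close> plus twice the
  integral of \<open>T h\<close> over the exceptional set, hence by \<open>2 \<epsilon> + 2 \<eta> sup |T h|\<close>. Splitting \<open>T h\<close> at a
  frequency of order \<open>1 / \<eta>\<close>, the low modes contribute a fixed fraction of \<open>\<parallel>T h\<parallel>\<^sub>1\<close> and the high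
  modes an exponentially small multiple of \<open>\<parallel>h\<parallel>\<close>. Since \<open>\<parallel>f\<parallel>\<^sup>2 - \<parallel>fdag\<parallel>\<^sup>2 = \<parallel>h\<parallel>\<^sup>2 + 2 Re \<langle>h, fdag\<rangle>\<close>, it
  remains to bound \<open>\<langle>h, fdag\<rangle>\<close>: its low modes are recovered from \<open>T h\<close> at exponential cost, and the
  Sobolev condition makes the high modes of \<open>fdag\<close> small. Cutting at a squared frequency of order
  \<open>- ln \<alpha>\<close> yields the logarithmic rate. The resulting bounds hold with vanishing \<open>o(1)\<close> terms.
\<close>

section \<open>Square integrable functions\<close>

text \<open>The exponents leave little room. The parameter that balances the rates is of size
  \<open>\<eta> * exp (- (pi\<^sup>2 / (16 * \<eta>\<^sup>2)) * t)\<close>, and dividing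
  \<open>\<eta>\<^sup>2 * exp (- (pi\<^sup>2 / (8 * \<eta>\<^sup>2)) * t)\<close> by its square
  gives exactly 1, so the general bound with exponent 1 / 8 would leave an error that does not
  vanish. The estimate is therefore proved with the larger exponent 27 / 200, of which 1 / 8 is a
  weakening; the difference 1 / 100 survives the division and beats the required power of \<eta>.
  This shapes the cutoff frequency: the share of the low modes that is moved to the left-hand side
  has to stay below 1, which bounds the cutoff from above, while the exponent, reduced by the part
  spent on summing the tail, bounds it from below. Completeness of the Fourier modes enters at one
  point: the Sobolev sum has to bound the norm of the remainder of \<open>fdag\<close>, not merely
  its coefficients. For \<open>h\<close>, bounds on single coefficients and the Cauchy-Schwarz
  inequality suffice.\<close>

abbreviation per_measure :: "real measure" where
  "per_measure \<equiv> lebesgue_on per"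

lemma per_lebesgue [simp, measurable]: "per \<in> sets lebesgue"
  by (simp add: per_def)

lemma finite_measure_per: "finite_measure per_measure"
  by (rule finite_measureI) (simp add: per_def emeasure_restrict_space)

lemma measure_per: "measure per_measure per = 2 * pi"
  by (simp add: per_def measure_restrict_space)

lemma continuous_measurable_per [intro]:
  "continuous_on UNIV f \<Longrightarrow> f \<in> borel_measurable per_measure"
  by (rule continuous_imp_measurable_on_sets_lebesgue) (auto intro: continuous_on_subset)

lemma bounded_integrable_per:
  fixes f :: "real \<Rightarrow> 'b::{banach, second_countable_topology}"
  assumes "f \<in> borel_measurable per_measure" and "\<And>x. x \<in> per \<Longrightarrow> norm (f x) \<le> B"
  shows "integrable per_measure f"
  by (rule finite_measure.integrable_const_bound [OF finite_measure_per _ assms(1), of B])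
     (auto intro!: AE_I2 assms(2))

lemma L2_measurable: "f \<in> L2 \<Longrightarrow> f \<in> borel_measurable per_measure"
  by (simp add: L2_def)

lemma L2_norm_sq_integrable: "f \<in> L2 \<Longrightarrow> integrable per_measure (\<lambda>x. (norm (f x))\<^sup>2)"
  by (simp add: L2_def)

lemma L2_norm_sq: "(L2_norm f)\<^sup>2 = (LINT x|per_measure. (norm (f x))\<^sup>2)"
  by (simp add: L2_norm_def)

lemma L2_norm_nonneg [simp]: "0 \<le> L2_norm f"
  by (simp add: L2_norm_def)

lemma L2_I_bounded:
  assumes "f \<in> borel_measurable per_measure" and "\<And>x. x \<in> per \<Longrightarrow> norm (f x) \<le> B"
  shows "f \<in> L2"
  using assms unfolding L2_def
  by (auto intro!: bounded_integrable_per [of _ "B\<^sup>2"] power_mono)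

lemma integrable_L2_mult:
  assumes "f \<in> L2" "g \<in> L2"
  shows "integrable per_measure (\<lambda>x. f x * cnj (g x))"
proof (rule Bochner_Integration.integrable_bound)
  show "integrable per_measure (\<lambda>x. (norm (f x))\<^sup>2 + (norm (g x))\<^sup>2)"
    using assms by (auto intro: L2_norm_sq_integrable)
  have "(\<lambda>x. cnj (g x)) \<in> borel_measurable per_measure"
    using measurable_compose [OF L2_measurable [OF assms(2)], of cnj borel]
    by (simp add: borel_measurable_continuous_onI continuous_on_cnj)
  then show "(\<lambda>x. f x * cnj (g x)) \<in> borel_measurable per_measure"
    using L2_measurable [OF assms(1)] by measurable
  have "a * b \<le> a\<^sup>2 + b\<^sup>2" if "0 \<le> a" "0 \<le> b" for a b :: real
    using sum_squares_bound [of a b] mult_nonneg_nonneg [OF that] by linarith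
  then show "AE x in per_measure. norm (f x * cnj (g x)) \<le> norm ((norm (f x))\<^sup>2 + (norm (g x))\<^sup>2)"
    by (intro AE_I2) (simp add: norm_mult)
qed

lemma L2_scale: "f \<in> L2 \<Longrightarrow> (\<lambda>x. c * f x) \<in> L2"
  unfolding L2_def by (auto simp: norm_mult power_mult_distrib)

lemma L2_add:
  assumes "f \<in> L2" "g \<in> L2"
  shows "(\<lambda>x. f x + g x) \<in> L2"
proof -
  have "integrable per_measure (\<lambda>x. (norm (f x + g x))\<^sup>2)"
  proof (rule Bochner_Integration.integrable_bound)
    show "integrable per_measure (\<lambda>x. 2 * (norm (f x))\<^sup>2 + 2 * (norm (g x))\<^sup>2)"
      using assms[THEN L2_norm_sq_integrable] by simp
    show "(\<lambda>x. (norm (f x + g x))\<^sup>2) \<in> borel_measurable per_measure"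
      using assms[THEN L2_measurable] by measurable
    have "(norm (a + b))\<^sup>2 \<le> 2 * (norm a)\<^sup>2 + 2 * (norm b)\<^sup>2" for a b :: complex
      using norm_triangle_ineq [of a b] sum_squares_bound [of "norm a" "norm b"]
        power_mono [of "norm (a + b)" "norm a + norm b" 2]
      by (simp add: power2_sum)
    then show "AE x in per_measure. norm ((norm (f x + g x))\<^sup>2) \<le> norm (2 * (norm (f x))\<^sup>2 + 2 * (norm (g x))\<^sup>2)"
      by (intro AE_I2) simp
  qed
  then show ?thesis
    using assms[THEN L2_measurable] by (auto simp: L2_def)
qed

lemma L2_diff:
  assumes "f \<in> L2" "g \<in> L2"
  shows "(\<lambda>x. f x - g x) \<in> L2"
  using L2_add [OF assms(1) L2_scale [OF assms(2), of "-1"]] by simp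

lemma L2_norm_add_sq:
  assumes "f \<in> L2" "g \<in> L2"
  shows "(L2_norm (\<lambda>x. f x + g x))\<^sup>2 =
    (L2_norm f)\<^sup>2 + 2 * Re (LINT x|per_measure. f x * cnj (g x)) + (L2_norm g)\<^sup>2"
proof -
  have *: "(norm (a + b))\<^sup>2 = (norm a)\<^sup>2 + 2 * Re (a * cnj b) + (norm b)\<^sup>2" for a b :: complex
    unfolding cmod_power2 by (simp add: power2_eq_square algebra_simps)
  define r where "r = (\<lambda>x. Re (f x * cnj (g x)))"
  have r: "integrable per_measure r"
    unfolding r_def using integrable_L2_mult [OF assms] by (rule integrable_Re)
  have "(L2_norm (\<lambda>x. f x + g x))\<^sup>2 =
      (LINT x|per_measure. (norm (f x))\<^sup>2 + 2 * r x + (norm (g x))\<^sup>2)"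
    unfolding L2_norm_sq * r_def ..
  also have "\<dots> = (L2_norm f)\<^sup>2 + 2 * (LINT x|per_measure. r x) + (L2_norm g)\<^sup>2"
    using r assms[THEN L2_norm_sq_integrable] by (simp add: L2_norm_sq)
  also have "(LINT x|per_measure. r x) = Re (LINT x|per_measure. f x * cnj (g x))"
    unfolding r_def using integrable_L2_mult [OF assms] by (rule integral_Re)
  finally show ?thesis .
qed

lemma L2_Cauchy_Schwarz:
  assumes "f \<in> L2" "g \<in> L2"
  shows "norm (LINT x|per_measure. f x * cnj (g x)) \<le> L2_norm f * L2_norm g"
proof -
  define I where "I = (LINT x|per_measure. f x * cnj (g x))"
  \<comment> \<open>Subtracting the multiple \<open>s * I\<close> of \<open>g\<close> aligns the
    phases, so that a quadratic in the real variable \<open>s\<close> remains. Its minimizer is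
    \<open>1 / (L2_norm g)\<^sup>2\<close>; if that norm vanishes, a large \<open>s\<close> forces
    \<open>I = 0\<close>.\<close>
  have quad: "0 \<le> (L2_norm f)\<^sup>2 - 2 * s * (norm I)\<^sup>2 + s\<^sup>2 * (norm I)\<^sup>2 * (L2_norm g)\<^sup>2" for s :: real
  proof -
    let ?c = "- (complex_of_real s * I)"
    have "0 \<le> (L2_norm (\<lambda>x. f x + ?c * g x))\<^sup>2" by simp
    also have "\<dots> = (L2_norm f)\<^sup>2 + 2 * Re (cnj ?c * I) + (norm ?c)\<^sup>2 * (L2_norm g)\<^sup>2"
    proof -
      have "(LINT x|per_measure. f x * cnj (?c * g x)) = cnj ?c * I"
        unfolding I_def by (subst integral_mult_right_zero [symmetric]) (simp add: mult_ac)
      moreover have "(L2_norm (\<lambda>x. ?c * g x))\<^sup>2 = (norm ?c)\<^sup>2 * (L2_norm g)\<^sup>2"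
        by (simp add: L2_norm_sq norm_mult power_mult_distrib)
      ultimately show ?thesis
        using L2_norm_add_sq [OF assms(1) L2_scale [OF assms(2)], of ?c] by simp
    qed
    also have "Re (cnj ?c * I) = - s * (norm I)\<^sup>2"
      unfolding cmod_power2 by (simp add: power2_eq_square algebra_simps)
    finally show ?thesis by (simp add: norm_mult power_mult_distrib)
  qed
  show ?thesis
  proof (cases "L2_norm g = 0")
    case True
    have "norm I = 0"
    proof (rule ccontr)
      assume "norm I \<noteq> 0"
      then have "0 < (norm I)\<^sup>2" by simp
      then show False
        using quad [of "((L2_norm f)\<^sup>2 + 1) / (norm I)\<^sup>2"] True zero_le_power2 [of "L2_norm f"]
        by simp
    qed
    then show ?thesis using True by (simp add: I_def)
  next
    case False
    then have g: "0 < (L2_norm g)\<^sup>2" by simp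
    have "0 \<le> (L2_norm f)\<^sup>2 - (norm I)\<^sup>2 / (L2_norm g)\<^sup>2"
    proof -
      have "s\<^sup>2 * i * g = s * i" if "s * g = 1" for s i g :: real
        using that by (simp add: power2_eq_square mult_ac)
      from this [of "1 / (L2_norm g)\<^sup>2"] show ?thesis
        using quad [of "1 / (L2_norm g)\<^sup>2"] g by simp
    qed
    then have "(norm I)\<^sup>2 \<le> (L2_norm f * L2_norm g)\<^sup>2"
      using g by (simp add: field_simps)
    then show ?thesis
      unfolding I_def by (rule power2_le_imp_le) simp
  qed
qed

text \<open>The form of the triangle inequality that density arguments with squared norms need: the
  factor 2 is harmless there.\<close>

lemma L2_norm_triangle_sq:
  assumes "f \<in> L2" "g \<in> L2"
  shows "(L2_norm (\<lambda>x. f x + g x))\<^sup>2 \<le> 2 * (L2_norm f)\<^sup>2 + 2 * (L2_norm g)\<^sup>2"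
proof -
  have "Re (LINT x|per_measure. f x * cnj (g x)) \<le> L2_norm f * L2_norm g"
    by (rule order_trans [OF complex_Re_le_cmod L2_Cauchy_Schwarz [OF assms]])
  then show ?thesis
    using L2_norm_add_sq [OF assms] sum_squares_bound [of "L2_norm f" "L2_norm g"] by linarith
qed

section \<open>Fourier modes and trigonometric polynomials\<close>

definition emode :: "int \<Rightarrow> real \<Rightarrow> complex" where
  "emode n x = exp (\<i> * of_int n * of_real x)"

lemma norm_emode [simp]: "norm (emode n x) = 1"
  by (simp add: emode_def)

lemma cnj_emode: "cnj (emode n x) = exp (- (\<i> * of_int n * of_real x))"
  by (simp add: emode_def exp_cnj)

lemma continuous_emode [continuous_intros]: "continuous_on A (emode n)"
  unfolding emode_def by (intro continuous_intros)

lemma emode_mult: "emode m x * emode n x = emode (m + n) x"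
  by (simp add: emode_def exp_add [symmetric] algebra_simps)

lemma emode_L2 [intro, simp]: "emode n \<in> L2"
  by (rule L2_I_bounded [of _ 1]) (auto intro: continuous_intros)

lemma fourier_coeff_eq:
  "(LINT x|per_measure. f x * cnj (emode n x)) = 2 * of_real pi * fourier_coeff f n"
  by (simp add: fourier_coeff_def cnj_emode)

text \<open>The sharp factor \<open>1 / sqrt (2 * pi)\<close> is weakened to 1, since the size of
  constants next to \<open>L2_norm\<close> is immaterial.\<close>

lemma fourier_coeff_bound:
  assumes "f \<in> L2" shows "norm (fourier_coeff f n) \<le> L2_norm f"
proof -
  have "(L2_norm (emode n))\<^sup>2 = 2 * pi"
    by (simp add: L2_norm_sq measure_per)
  then have e: "L2_norm (emode n) = sqrt (2 * pi)"
    by (metis L2_norm_nonneg real_sqrt_unique)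
  have "2 * pi * norm (fourier_coeff f n) \<le> L2_norm f * sqrt (2 * pi)"
    using L2_Cauchy_Schwarz [OF assms emode_L2, of n] fourier_coeff_eq [of f n] e
    by (simp add: norm_mult)
  also have "sqrt (2 * pi) \<le> 2 * pi"
    using pi_ge_two by (intro real_le_lsqrt) (auto simp: power2_eq_square)
  finally show ?thesis
    by (simp add: mult_left_mono)
qed

lemma fourier_coeff_diff:
  assumes "f \<in> L2" "g \<in> L2"
  shows "fourier_coeff (\<lambda>x. f x - g x) n = fourier_coeff f n - fourier_coeff g n"
proof -
  have "2 * of_real pi * fourier_coeff (\<lambda>x. f x - g x) n
      = 2 * of_real pi * (fourier_coeff f n - fourier_coeff g n)"
    using assms integrable_L2_mult [OF _ emode_L2]
    by (simp add: fourier_coeff_eq [symmetric] left_diff_distrib right_diff_distrib)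
  then show ?thesis by simp
qed

lemma integral_emode: "(LINT x|per_measure. emode n x) = (if n = 0 then 2 * of_real pi else 0)"
proof (cases "n = 0")
  case True
  then show ?thesis by (simp add: emode_def measure_per scaleR_conv_of_real)
next
  case False
  let ?F = "\<lambda>x::real. emode n x / (\<i> * of_int n)"
  have "(emode n has_integral ?F pi - ?F (-pi)) {-pi..pi}"
  proof (rule fundamental_theorem_of_calculus)
    fix x :: real
    have "((\<lambda>z. exp (\<i> * of_int n * z) / (\<i> * of_int n)) has_field_derivative
        exp (\<i> * of_int n * of_real x)) (at (of_real x))"
      using False by (auto intro!: derivative_eq_intros)
    from has_vector_derivative_real_field [OF this]
    show "(?F has_vector_derivative emode n x) (at x within {-pi..pi})"
      by (simp add: emode_def)
  qed simp
  moreover have "emode n pi = emode n (-pi)"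
  proof -
    have "emode n pi = emode n (-pi) * exp (2 * of_int n * of_real pi * \<i>)"
      unfolding emode_def exp_add [symmetric] by (simp add: algebra_simps)
    also have "exp (2 * of_int n * of_real pi * \<i>) = 1"
      using exp_integer_2pi [of "of_int n"] by (simp add: mult_ac)
    finally show ?thesis by simp
  qed
  ultimately have "(emode n has_integral 0) {-pi<..<pi}"
    by (simp add: has_integral_Icc_iff_Ioo)
  moreover have "integrable per_measure (emode n)"
    by (rule bounded_integrable_per [of _ 1]) (auto intro: continuous_intros)
  ultimately show ?thesis
    using False by (simp add: lebesgue_integral_eq_integral per_def integral_unique)
qed

lemma emode_orthogonal:
  "(LINT x|per_measure. emode m x * cnj (emode n x)) = (if m = n then 2 * of_real pi else 0)"
proof -
  have "emode m x * cnj (emode n x) = emode (m - n) x" for x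
    by (simp add: cnj_emode) (simp add: emode_def exp_add [symmetric] algebra_simps)
  then show ?thesis by (simp add: integral_emode)
qed

definition trig :: "int set \<Rightarrow> (int \<Rightarrow> complex) \<Rightarrow> real \<Rightarrow> complex" where
  "trig A c x = (\<Sum>n\<in>A. c n * emode n x)"

lemma trig_L2 [intro, simp]: "trig A c \<in> L2"
proof (rule L2_I_bounded)
  show "trig A c \<in> borel_measurable per_measure"
    unfolding trig_def by (intro continuous_measurable_per continuous_intros)
  show "norm (trig A c x) \<le> (\<Sum>n\<in>A. norm (c n))" for x
    unfolding trig_def by (rule sum_norm_le) (simp add: norm_mult)
qed

lemma inner_trig:
  assumes "f \<in> L2"
  shows "(LINT x|per_measure. f x * cnj (trig A c x)) = 2 * of_real pi * (\<Sum>n\<in>A. fourier_coeff f n * cnj (c n))"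
proof -
  have "(LINT x|per_measure. f x * cnj (trig A c x))
      = (LINT x|per_measure. (\<Sum>n\<in>A. cnj (c n) * (f x * cnj (emode n x))))"
    by (simp add: trig_def sum_distrib_left mult_ac)
  also have "\<dots> = (\<Sum>n\<in>A. cnj (c n) * (2 * of_real pi * fourier_coeff f n))"
    using integrable_L2_mult [OF assms emode_L2]
    by (subst Bochner_Integration.integral_sum) (auto simp: fourier_coeff_eq)
  finally show ?thesis by (simp add: sum_distrib_left mult_ac)
qed

lemma fourier_coeff_trig:
  assumes "finite A"
  shows "fourier_coeff (trig A c) m = (if m \<in> A then c m else 0)"
proof -
  have "2 * of_real pi * fourier_coeff (trig A c) m
      = (LINT x|per_measure. (\<Sum>n\<in>A. c n * (emode n x * cnj (emode m x))))"
    unfolding fourier_coeff_eq [symmetric, of "trig A c"]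
    by (simp only: trig_def sum_distrib_right mult.assoc)
  also have "\<dots> = (\<Sum>n\<in>A. c n * (if n = m then 2 * of_real pi else 0))"
    using integrable_L2_mult [OF emode_L2 emode_L2]
    by (subst Bochner_Integration.integral_sum) (auto simp: emode_orthogonal)
  also have "\<dots> = 2 * of_real pi * (if m \<in> A then c m else 0)"
    using assms by (simp add: if_distrib sum.delta mult.commute cong: if_cong)
  finally show ?thesis by simp
qed

lemma L2_norm_trig_sq:
  assumes "finite A"
  shows "(L2_norm (trig A c))\<^sup>2 = 2 * pi * (\<Sum>n\<in>A. (norm (c n))\<^sup>2)"
proof -
  have "complex_of_real ((L2_norm (trig A c))\<^sup>2) = (LINT x|per_measure. trig A c x * cnj (trig A c x))"
    by (simp add: L2_norm_sq complex_norm_square [symmetric] del: of_real_power)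
  also have "\<dots> = 2 * of_real pi * (\<Sum>n\<in>A. c n * cnj (c n))"
    unfolding inner_trig [OF trig_L2] using assms by (simp add: fourier_coeff_trig)
  also have "\<dots> = complex_of_real (2 * pi * (\<Sum>n\<in>A. (norm (c n))\<^sup>2))"
    by (simp add: complex_norm_square [symmetric])
  finally show ?thesis using of_real_eq_iff by blast
qed

text \<open>Completing the square in the coefficients: \<open>c\<close> enters only through the last
  sum, which vanishes exactly at the Fourier coefficients. Both best approximation and the norm of
  the remainder are read off from this identity.\<close>

lemma L2_norm_diff_trig_sq:
  assumes "f \<in> L2" "finite A"
  shows "(L2_norm (\<lambda>x. f x - trig A c x))\<^sup>2 =
    (L2_norm f)\<^sup>2 - 2 * pi * (\<Sum>n\<in>A. (norm (fourier_coeff f n))\<^sup>2)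
      + 2 * pi * (\<Sum>n\<in>A. (norm (fourier_coeff f n - c n))\<^sup>2)"
proof -
  have *: "(norm (a - b))\<^sup>2 = (norm a)\<^sup>2 - 2 * Re (a * cnj b) + (norm b)\<^sup>2" for a b :: complex
    unfolding cmod_power2 by (simp add: power2_eq_square algebra_simps)
  define S where "S = (\<Sum>n\<in>A. Re (fourier_coeff f n * cnj (c n)))"
  have 1: "(L2_norm (\<lambda>x. f x + trig A (\<lambda>n. - c n) x))\<^sup>2 =
     (L2_norm f)\<^sup>2 + 2 * Re (2 * of_real pi * (\<Sum>n\<in>A. fourier_coeff f n * cnj (- c n)))
     + 2 * pi * (\<Sum>n\<in>A. (norm (c n))\<^sup>2)"
    using L2_norm_add_sq [OF assms(1) trig_L2, of A "\<lambda>n. - c n"]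
    by (simp only: inner_trig [OF assms(1)] L2_norm_trig_sq [OF assms(2)] norm_minus_cancel)
  have 2: "Re (2 * of_real pi * (\<Sum>n\<in>A. fourier_coeff f n * cnj (- c n))) = - 2 * pi * S"
    by (simp add: sum_negf S_def)
  have 3: "(\<lambda>x. f x + trig A (\<lambda>n. - c n) x) = (\<lambda>x. f x - trig A c x)"
    by (simp add: trig_def sum_negf)
  have 4: "(\<Sum>n\<in>A. (norm (fourier_coeff f n - c n))\<^sup>2) =
      (\<Sum>n\<in>A. (norm (fourier_coeff f n))\<^sup>2) - 2 * S + (\<Sum>n\<in>A. (norm (c n))\<^sup>2)"
    unfolding * sum.distrib sum_subtractf sum_distrib_left S_def by (rule refl)
  show ?thesis
    using 1 unfolding 2 3 4 by (simp add: algebra_simps)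
qed

section \<open>The algebra of trigonometric polynomials and uniform approximation\<close>

definition trig_poly :: "(real \<Rightarrow> complex) \<Rightarrow> bool" where
  "trig_poly q \<longleftrightarrow> (\<exists>A c. finite A \<and> q = trig A c)"

lemma trig_extend:
  assumes "finite B" "A \<subseteq> B"
  shows "trig A c = trig B (\<lambda>n. if n \<in> A then c n else 0)"
  unfolding trig_def using assms by (intro ext sum.mono_neutral_cong_left) auto

lemma trig_poly_add:
  assumes "trig_poly p" "trig_poly q"
  shows "trig_poly (\<lambda>x. p x + q x)"
proof -
  obtain A c B d where *: "finite A" "p = trig A c" "finite B" "q = trig B d"
    using assms unfolding trig_poly_def by blast
  have "\<exists>c'. p = trig (A \<union> B) c'" "\<exists>d'. q = trig (A \<union> B) d'"
    unfolding *(2,4) by (rule exI, rule trig_extend; use * in auto)+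
  then obtain c' d' where "p = trig (A \<union> B) c'" "q = trig (A \<union> B) d'"
    by blast
  then have "(\<lambda>x. p x + q x) = trig (A \<union> B) (\<lambda>n. c' n + d' n)"
    by (auto simp: trig_def sum.distrib distrib_right)
  then show ?thesis
    using * unfolding trig_poly_def by blast
qed

lemma trig_poly_mode_mult:
  assumes "trig_poly q"
  shows "trig_poly (\<lambda>x. a * emode n x * q x)"
proof -
  obtain B d where q: "finite B" "q = trig B d"
    using assms unfolding trig_poly_def by blast
  have "a * emode n x * q x = trig ((+) n ` B) (\<lambda>m. a * d (m - n)) x" for x
    unfolding q(2) trig_def sum_distrib_left
    by (subst sum.reindex) (auto simp: emode_mult [symmetric] mult_ac)
  then show ?thesis
    using q(1) unfolding trig_poly_def by blast
qed

lemma trig_poly_mode: "trig_poly (\<lambda>x. a * emode n x)"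
  unfolding trig_poly_def
  by (rule exI [of _ "{n}"], rule exI [of _ "\<lambda>_. a"]) (simp add: trig_def fun_eq_iff)

lemma trig_poly_const: "trig_poly (\<lambda>x. a)"
  using trig_poly_mode [of a 0] by (simp add: emode_def)

lemma trig_poly_sum:
  assumes "finite A" "\<And>n. n \<in> A \<Longrightarrow> trig_poly (f n)"
  shows "trig_poly (\<lambda>x. \<Sum>n\<in>A. f n x)"
  using assms by (induction A rule: finite_induct) (auto intro: trig_poly_const trig_poly_add)

lemma trig_poly_mult:
  assumes "trig_poly p" "trig_poly q"
  shows "trig_poly (\<lambda>x. p x * q x)"
proof -
  obtain A c where p: "finite A" "p = trig A c"
    using assms unfolding trig_poly_def by blast
  have "trig_poly (\<lambda>x. \<Sum>n\<in>A. c n * emode n x * q x)"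
    by (intro trig_poly_sum trig_poly_mode_mult p assms)
  then show ?thesis
    by (simp add: p trig_def sum_distrib_right)
qed

lemma trig_poly_L2: "trig_poly q \<Longrightarrow> q \<in> L2"
  by (auto simp: trig_poly_def)

text \<open>Restricting plane polynomials to the unit circle gives trigonometric polynomials,
  because the latter form an algebra; only the linear generators need computation.\<close>

lemma trig_poly_real_polynomial_function:
  assumes "real_polynomial_function (r :: complex \<Rightarrow> real)"
  shows "trig_poly (\<lambda>x. of_real (r (exp (\<i> * of_real x))))"
  using assms
proof (induction r rule: real_polynomial_function.induct)
  case (linear f)
  have f: "f z = Re z * f 1 + Im z * f \<i>" for z
  proof -
    have "z = Re z *\<^sub>R 1 + Im z *\<^sub>R \<i>"
      by (simp add: complex_eq_iff)
    then have "f z = f (Re z *\<^sub>R 1 + Im z *\<^sub>R \<i>)"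
      by simp
    then show ?thesis
      using bounded_linear.linear [OF linear] by (simp add: linear_add linear_scale)
  qed
  \<comment> \<open>On the circle the linear functional is
    \<open>f 1 * cos x + f \<i> * sin x\<close>; Euler's formulas turn this into the frequencies 1
    and -1.\<close>
  have "complex_of_real (f (exp (\<i> * of_real x)))
     = (of_real (f 1) / 2 - \<i> * of_real (f \<i>) / 2) * emode 1 x
       + (of_real (f 1) / 2 + \<i> * of_real (f \<i>) / 2) * emode (-1) x" for x
    by (subst f) (simp add: complex_eq_iff emode_def Re_exp Im_exp algebra_simps)
  then show ?case
    by (simp only:) (intro trig_poly_add trig_poly_mode)
qed (auto intro: trig_poly_const trig_poly_add trig_poly_mult)

text \<open>
  Vanishing near the ends of the period makes \<open>G \<circ> Arg\<close> continuous across the branch cut, so that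
  the Stone-Weierstrass theorem applies on the unit circle.
\<close>

lemma trig_poly_uniform_approx:
  fixes G :: "real \<Rightarrow> complex"
  assumes G: "continuous_on UNIV G" and a: "0 < a" "a < pi"
    and G0: "\<And>x. a \<le> \<bar>x\<bar> \<Longrightarrow> G x = 0" and e: "0 < e"
  shows "\<exists>q. trig_poly q \<and> (\<forall>x\<in>per. norm (G x - q x) < e)"
proof -
  let ?S = "sphere (0::complex) 1"
  have "continuous_on ?S (\<lambda>z. G (Arg z))"
    unfolding continuous_on_eq_continuous_within
  proof
    fix z :: complex assume z: "z \<in> ?S"
    show "continuous (at z within ?S) (\<lambda>z. G (Arg z))"
    proof (cases "z \<in> \<real>\<^sub>\<le>\<^sub>0")
      case False
      then have "continuous (at z within ?S) Arg"
        by (rule continuous_within_Arg)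
      moreover have "isCont G (Arg z)"
        using G by (simp add: continuous_on_eq_continuous_at)
      ultimately show ?thesis
        by (rule continuous_within_compose3 [rotated])
    next
      case True
      then have "z = -1"
        using z by (auto elim!: nonpos_Reals_cases)
      have cos_a: "-1 < cos a"
        using cos_monotone_0_pi [of a pi] a by simp
      have zero: "G (Arg w) = 0" if "Re w < cos a" "w \<in> ?S" for w
      proof (rule G0, rule ccontr)
        assume "\<not> a \<le> \<bar>Arg w\<bar>"
        then have "cos a \<le> cos \<bar>Arg w\<bar>"
          using a by (intro cos_monotone_0_pi_le) auto
        moreover have "cos (Arg w) = Re w"
          using that(2) by (subst cos_Arg) auto
        ultimately show False
          using that(1) by simp
      qed
      have "eventually (\<lambda>w. G (Arg w) = G (Arg z)) (at z within ?S)"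
        unfolding eventually_at_topological
      proof (intro exI conjI ballI impI)
        show "open {w. Re w < cos a}"
          by (intro open_Collect_less continuous_intros)
        show "z \<in> {w. Re w < cos a}"
          using \<open>z = -1\<close> cos_a by simp
        show "G (Arg w) = G (Arg z)" if "w \<in> {w. Re w < cos a}" "w \<in> ?S" for w
          using zero [of w] zero [of z] that z cos_a \<open>z = -1\<close> by simp
      qed
      then show ?thesis
        unfolding continuous_within by (rule tendsto_eventually)
    qed
  qed
  then obtain p where p: "polynomial_function p" "\<And>z. z \<in> ?S \<Longrightarrow> norm (G (Arg z) - p z) < e"
    using Stone_Weierstrass_polynomial_function [of ?S "\<lambda>z. G (Arg z)" e] e by auto
  define q where "q x = p (exp (\<i> * of_real x))" for x :: real
  have "real_polynomial_function (\<lambda>z. Re (p z))" "real_polynomial_function (\<lambda>z. Im (p z))"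
    using p(1) bounded_linear_Re bounded_linear_Im by (auto simp: polynomial_function_def o_def)
  then have "trig_poly (\<lambda>x. of_real (Re (q x)) + \<i> * of_real (Im (q x)))"
    unfolding q_def
    by (intro trig_poly_add trig_poly_mult trig_poly_const trig_poly_real_polynomial_function)
  moreover have "(\<lambda>x. of_real (Re (q x)) + \<i> * of_real (Im (q x))) = q"
    by (intro ext) (simp add: complex_eq [symmetric])
  moreover have "norm (G x - q x) < e" if "x \<in> per" for x
  proof -
    have "Arg (exp (\<i> * of_real x)) = x"
      using that by (subst Arg_exp) (auto simp: per_def)
    then show ?thesis
      using p(2) [of "exp (\<i> * of_real x)"] by (simp add: q_def)
  qed
  ultimately show ?thesis by auto
qed

section \<open>Density of the trigonometric polynomials in the square integrable functions\<close>

definition trig_approx :: "(real \<Rightarrow> complex) \<Rightarrow> bool" where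
  "trig_approx f \<longleftrightarrow> (\<forall>e>0. \<exists>q. trig_poly q \<and> (L2_norm (\<lambda>x. f x - q x))\<^sup>2 < e)"

lemma L2_dominated_convergence:
  assumes "f \<in> L2" "\<And>k. g k \<in> L2" "AE x in per_measure. (\<lambda>k. g k x) \<longlonglongrightarrow> f x"
    and "integrable per_measure w" "\<And>k. AE x in per_measure. (norm (f x - g k x))\<^sup>2 \<le> w x"
  shows "(\<lambda>k. (L2_norm (\<lambda>x. f x - g k x))\<^sup>2) \<longlonglongrightarrow> 0"
proof -
  have "(\<lambda>k. LINT x|per_measure. (norm (f x - g k x))\<^sup>2) \<longlonglongrightarrow> (LINT x|per_measure. 0 :: real)"
  proof (rule integral_dominated_convergence [OF _ _ assms(4)])
    show "(\<lambda>x. (norm (f x - g k x))\<^sup>2) \<in> borel_measurable per_measure" for k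
      using L2_measurable [OF L2_diff [OF assms(1,2)]] by measurable
    show "AE x in per_measure. (\<lambda>k. (norm (f x - g k x))\<^sup>2) \<longlonglongrightarrow> 0"
      using assms(3)
    proof eventually_elim
      case (elim x)
      have "(\<lambda>k. (norm (f x - g k x))\<^sup>2) \<longlonglongrightarrow> (norm (f x - f x))\<^sup>2"
        by (intro tendsto_intros elim)
      then show ?case by simp
    qed
    show "AE x in per_measure. norm ((norm (f x - g k x))\<^sup>2) \<le> w x" for k
      using assms(5) by simp
  qed simp
  then show ?thesis by (simp add: L2_norm_sq)
qed

lemma trig_approx_limit:
  assumes "f \<in> L2" "\<And>k::nat. g k \<in> L2" "\<And>k. trig_approx (g k)"
    and "(\<lambda>k. (L2_norm (\<lambda>x. f x - g k x))\<^sup>2) \<longlonglongrightarrow> 0"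
  shows "trig_approx f"
  unfolding trig_approx_def
proof (intro allI impI)
  fix e :: real assume "0 < e"
  then have "eventually (\<lambda>k. (L2_norm (\<lambda>x. f x - g k x))\<^sup>2 < e / 4) sequentially"
    by (intro order_tendstoD(2) [OF assms(4)]) simp
  then obtain k where k: "(L2_norm (\<lambda>x. f x - g k x))\<^sup>2 < e / 4"
    using eventually_happens' [OF sequentially_bot] by blast
  obtain q where q: "trig_poly q" "(L2_norm (\<lambda>x. g k x - q x))\<^sup>2 < e / 4"
    using assms(3) [of k] \<open>0 < e\<close> unfolding trig_approx_def by (meson divide_pos_pos zero_less_numeral)
  have "(L2_norm (\<lambda>x. (f x - g k x) + (g k x - q x)))\<^sup>2
      \<le> 2 * (L2_norm (\<lambda>x. f x - g k x))\<^sup>2 + 2 * (L2_norm (\<lambda>x. g k x - q x))\<^sup>2"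
    using assms(1,2) trig_poly_L2 [OF q(1)] by (intro L2_norm_triangle_sq L2_diff)
  then have "(L2_norm (\<lambda>x. f x - q x))\<^sup>2 < e"
    using k q(2) by simp
  then show "\<exists>q. trig_poly q \<and> (L2_norm (\<lambda>x. f x - q x))\<^sup>2 < e"
    using q(1) by blast
qed

lemma trig_approx_continuous:
  fixes G :: "real \<Rightarrow> complex"
  assumes "continuous_on UNIV G" "0 < a" "a < pi" "\<And>x. a \<le> \<bar>x\<bar> \<Longrightarrow> G x = 0" "G \<in> L2"
  shows "trig_approx G"
  unfolding trig_approx_def
proof (intro allI impI)
  fix e :: real assume e: "0 < e"
  define d where "d = sqrt (e / (4 * pi))"
  have d: "0 < d" "d\<^sup>2 = e / (4 * pi)" using e by (auto simp: d_def)
  obtain q where q: "trig_poly q" "\<And>x. x \<in> per \<Longrightarrow> norm (G x - q x) < d"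
    using trig_poly_uniform_approx [OF assms(1-4) d(1)] by auto
  have "(L2_norm (\<lambda>x. G x - q x))\<^sup>2 \<le> (LINT x|per_measure. d\<^sup>2)"
    unfolding L2_norm_sq
  proof (rule integral_mono)
    show "integrable per_measure (\<lambda>x. (norm (G x - q x))\<^sup>2)"
      by (intro L2_norm_sq_integrable L2_diff assms trig_poly_L2 q(1))
    show "integrable per_measure (\<lambda>x. d\<^sup>2)"
      by (rule bounded_integrable_per [of _ "d\<^sup>2"]) auto
    show "(norm (G x - q x))\<^sup>2 \<le> d\<^sup>2" if "x \<in> space per_measure" for x
      using q(2) [of x] that by (intro power_mono) auto
  qed
  also have "\<dots> = e / 2"
    by (simp add: measure_per d(2))
  also have "\<dots> < e"
    using e by simp
  finally show "\<exists>q. trig_poly q \<and> (L2_norm (\<lambda>x. G x - q x))\<^sup>2 < e"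
    using q(1) by blast
qed

text \<open>Measurability supplies continuous functions converging almost everywhere, but without a
  common bound and without vanishing near the ends of the period. Both are repaired without spoiling
  the limit.\<close>

lemma trig_approx_bounded:
  assumes f: "f \<in> borel_measurable per_measure" and B: "\<And>x. x \<in> per \<Longrightarrow> norm (f x) \<le> B" and "0 < B"
  shows "trig_approx f"
proof -
  have "f measurable_on per"
    using f by (simp add: measurable_on_iff_borel_measurable)
  then obtain N g where N: "negligible N" and g: "\<And>n::nat. continuous_on UNIV (g n)"
    and lim: "\<And>x. x \<notin> N \<Longrightarrow> (\<lambda>n. g n x) \<longlonglongrightarrow> (if x \<in> per then f x else 0)"
    unfolding measurable_on_def by blast
  \<comment> \<open>The radial retraction onto the disc of radius \<open>B\<close>: it is continuous
    and fixes the values of \<open>f\<close>, so limits are kept and dominated convergence becomes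
    available.\<close>
  define clip :: "complex \<Rightarrow> complex" where "clip z = (B / max B (norm z)) *\<^sub>R z" for z
  \<comment> \<open>Zero within distance \<open>1 / (n + 1)\<close> of the ends and one from
    distance \<open>2 / (n + 1)\<close> on, so at each interior point it is eventually 1.\<close>
  define cutoff :: "nat \<Rightarrow> real \<Rightarrow> real" where "cutoff n x = max 0 (min 1 (real (Suc n) * (pi - \<bar>x\<bar>) - 1))" for n x
  define h where "h n x = cutoff n x *\<^sub>R clip (g n x)" for n x
  have clip_cont: "continuous_on UNIV clip"
    unfolding clip_def using \<open>0 < B\<close> by (intro continuous_intros) auto
  have clip_bound: "norm (clip z) \<le> B" for z
    using \<open>0 < B\<close> by (simp add: clip_def field_simps max_def)
  have clip_id: "clip z = z" if "norm z \<le> B" for z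
    using that \<open>0 < B\<close> by (simp add: clip_def)
  have h_cont: "continuous_on UNIV (h n)" for n
  proof -
    have "continuous_on UNIV (\<lambda>x. clip (g n x))"
      by (rule continuous_on_compose2 [OF clip_cont g]) auto
    then show ?thesis
      unfolding h_def cutoff_def by (intro continuous_intros)
  qed
  have h_bound: "norm (h n x) \<le> B" for n x
  proof -
    have "norm (h n x) = \<bar>cutoff n x\<bar> * norm (clip (g n x))" by (simp add: h_def)
    also have "\<dots> \<le> 1 * B"
      using clip_bound \<open>0 < B\<close> by (intro mult_mono) (auto simp: cutoff_def)
    finally show ?thesis by simp
  qed
  have fL2: "f \<in> L2"
    using f B by (rule L2_I_bounded)
  have hL2: "h n \<in> L2" for n
    using continuous_measurable_per [OF h_cont] h_bound by (rule L2_I_bounded)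
  have "trig_approx (h n)" for n
  proof (rule trig_approx_continuous [OF h_cont _ _ _ hL2])
    let ?a = "pi - 1 / real (Suc n)"
    have "1 / real (Suc n) \<le> 1" by simp
    then show "0 < ?a" using pi_gt3 by linarith
    show "?a < pi" by simp
    fix x assume "?a \<le> \<bar>x\<bar>"
    then have "real (Suc n) * (pi - \<bar>x\<bar>) - 1 \<le> 0"
      by (simp add: field_simps)
    then have "cutoff n x = 0"
      unfolding cutoff_def by linarith
    then show "h n x = 0" by (simp add: h_def)
  qed
  moreover have "(\<lambda>n. (L2_norm (\<lambda>x. f x - h n x))\<^sup>2) \<longlonglongrightarrow> 0"
  proof (rule L2_dominated_convergence [OF fL2 hL2])
    have "AE x in lebesgue. x \<notin> N"
      using N by (simp add: negligible_iff_null_sets AE_not_in)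
    then show "AE x in per_measure. (\<lambda>n. h n x) \<longlonglongrightarrow> f x"
      unfolding AE_restrict_space_iff [of per lebesgue, simplified]
    proof eventually_elim
      case (elim x)
      show ?case
      proof
        assume x: "x \<in> per"
        then have "(\<lambda>n. g n x) \<longlonglongrightarrow> f x"
          using lim [OF elim] by simp
        then have c: "(\<lambda>n. clip (g n x)) \<longlonglongrightarrow> clip (f x)"
          using clip_cont by (intro continuous_on_tendsto_compose [of UNIV clip]) auto
        have pos: "0 < pi - \<bar>x\<bar>"
          using x by (auto simp: per_def)
        obtain m where m: "2 / (pi - \<bar>x\<bar>) < real m"
          using reals_Archimedean2 by blast
        have "cutoff n x = 1" if "m \<le> n" for n
        proof -
          have "2 / (pi - \<bar>x\<bar>) \<le> real (Suc n)"
            using m that by linarith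
          then have "2 \<le> real (Suc n) * (pi - \<bar>x\<bar>)"
            using pos by (simp add: pos_divide_le_eq)
          then show ?thesis
            unfolding cutoff_def by linarith
        qed
        then have "(\<lambda>n. cutoff n x) \<longlonglongrightarrow> 1"
          by (intro tendsto_eventually) (auto simp: eventually_sequentially)
        then have "(\<lambda>n. cutoff n x *\<^sub>R clip (g n x)) \<longlonglongrightarrow> 1 *\<^sub>R clip (f x)"
          using c by (rule tendsto_scaleR)
        then show "(\<lambda>n. h n x) \<longlonglongrightarrow> f x"
          using clip_id [OF B [OF x]] by (simp add: h_def)
      qed
    qed
    show "integrable per_measure (\<lambda>x. (2 * B)\<^sup>2)"
      by (rule bounded_integrable_per [of _ "(2 * B)\<^sup>2"]) auto
    show "AE x in per_measure. (norm (f x - h n x))\<^sup>2 \<le> (2 * B)\<^sup>2" for n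
    proof (rule AE_I2)
      fix x assume "x \<in> space per_measure"
      then have "norm (f x - h n x) \<le> B + B"
        using norm_triangle_ineq4 [of "f x" "h n x"] B [of x] h_bound [of n x] by simp
      then show "(norm (f x - h n x))\<^sup>2 \<le> (2 * B)\<^sup>2"
        by (intro power_mono) auto
    qed
  qed
  ultimately show ?thesis
    by (intro trig_approx_limit [OF fL2 hL2])
qed

text \<open>Truncation by height reduces to the bounded case; at each point the error is either 0 or
  \<open>f x\<close>, hence dominated by the integrable square of \<open>f\<close>.\<close>

lemma trig_approx_L2:
  assumes f: "f \<in> L2"
  shows "trig_approx f"
proof -
  define g where "g k x = (if norm (f x) \<le> real (Suc k) then f x else 0)" for k x
  have meas: "g k \<in> borel_measurable per_measure" for k
    unfolding g_def using L2_measurable [OF f] by measurable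
  have bound: "norm (g k x) \<le> real (Suc k)" for k x
    by (simp add: g_def)
  have L2: "g k \<in> L2" for k
    using meas bound by (intro L2_I_bounded)
  moreover have "trig_approx (g k)" for k
    using meas bound by (intro trig_approx_bounded [of _ "real (Suc k)"]) auto
  moreover have "(\<lambda>k. (L2_norm (\<lambda>x. f x - g k x))\<^sup>2) \<longlonglongrightarrow> 0"
  proof (rule L2_dominated_convergence [OF f L2])
    show "AE x in per_measure. (\<lambda>k. g k x) \<longlonglongrightarrow> f x"
    proof (rule AE_I2)
      fix x
      obtain m where "norm (f x) < real m" using reals_Archimedean2 by blast
      then have "g k x = f x" if "m \<le> k" for k
        using that by (simp add: g_def)
      then show "(\<lambda>k. g k x) \<longlonglongrightarrow> f x"
        by (intro tendsto_eventually) (auto simp: eventually_sequentially)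
    qed
    show "integrable per_measure (\<lambda>x. (norm (f x))\<^sup>2)"
      using f by (rule L2_norm_sq_integrable)
    show "AE x in per_measure. (norm (f x - g k x))\<^sup>2 \<le> (norm (f x))\<^sup>2" for k
      by (intro AE_I2) (simp add: g_def)
  qed
  ultimately show ?thesis
    by (intro trig_approx_limit [OF f])
qed

text \<open>
  Truncated Fourier series are best approximations, so density of the trigonometric polynomials
  bounds the remainder by any upper bound for the sums of squares of the missing coefficients.
\<close>

lemma fourier_remainder_bound:
  assumes f: "f \<in> L2" and A: "finite A"
    and S: "\<And>F. finite F \<Longrightarrow> F \<inter> A = {} \<Longrightarrow> (\<Sum>n\<in>F. (norm (fourier_coeff f n))\<^sup>2) \<le> S"
  shows "(L2_norm (\<lambda>x. f x - trig A (fourier_coeff f) x))\<^sup>2 \<le> 2 * pi * S"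
proof (rule field_le_epsilon)
  fix e :: real assume "0 < e"
  then obtain W c where W: "finite W" "(L2_norm (\<lambda>x. f x - trig W c x))\<^sup>2 < e"
    using trig_approx_L2 [OF f] unfolding trig_approx_def trig_poly_def by blast
  define F where "F = A \<union> W"
  have F: "finite F" "A \<subseteq> F" "W \<subseteq> F" using A W by (auto simp: F_def)
  let ?s = "\<lambda>A. \<Sum>n\<in>A. (norm (fourier_coeff f n))\<^sup>2"
  \<comment> \<open>The approximant on \<open>W\<close> is also a competitor on the larger set
    \<open>F\<close>, where the Fourier sum is optimal.\<close>
  have "(L2_norm f)\<^sup>2 - 2 * pi * ?s F \<le> (L2_norm (\<lambda>x. f x - trig W c x))\<^sup>2"
    unfolding trig_extend [OF F(1,3)] L2_norm_diff_trig_sq [OF f F(1)]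
    by (simp add: sum_nonneg)
  moreover have "(L2_norm (\<lambda>x. f x - trig A (fourier_coeff f) x))\<^sup>2 = (L2_norm f)\<^sup>2 - 2 * pi * ?s A"
    unfolding L2_norm_diff_trig_sq [OF f A] by simp
  moreover have "?s F = ?s A + ?s (F - A)"
    using sum.subset_diff [OF F(2,1)] by (simp add: add.commute)
  moreover have "?s (F - A) \<le> S"
    using F by (intro S) auto
  then have "2 * pi * ?s (F - A) \<le> 2 * pi * S"
    by (intro mult_left_mono) auto
  ultimately show "(L2_norm (\<lambda>x. f x - trig A (fourier_coeff f) x))\<^sup>2 \<le> 2 * pi * S + e"
    using W(2) by (simp only: distrib_left)
qed

section \<open>The forward operator\<close>

definition heat_weight :: "real \<Rightarrow> int \<Rightarrow> real" where
  "heat_weight t n = exp (- (of_int n)\<^sup>2 * t)"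

lemma heat_weight_pos [simp]: "0 < heat_weight t n" "0 \<le> heat_weight t n"
  by (simp_all add: heat_weight_def)

lemma summable_heat_weight:
  assumes "0 < t" shows "heat_weight t summable_on UNIV"
proof -
  have nat: "(\<lambda>k. heat_weight t (int k)) summable_on UNIV"
  proof (rule norm_summable_imp_summable_on, rule summable_comparison_test')
    show "summable (\<lambda>k. exp (- t) ^ k)"
      using assms by (intro summable_geometric) simp
    fix k :: nat
    have "real k \<le> (real k)\<^sup>2"
      by (metis of_nat_le_iff of_nat_power power2_nat_le_imp_le power2_nat_le_eq_le le_square power2_eq_square)
    then have "real k * t \<le> (real k)\<^sup>2 * t"
      using assms by (intro mult_right_mono) auto
    then show "norm (norm (heat_weight t (int k))) \<le> exp (- t) ^ k"
      by (simp add: heat_weight_def exp_of_nat_mult [symmetric])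
  qed
  have pos: "heat_weight t summable_on range int"
    using nat by (subst summable_on_reindex) (auto simp: o_def)
  have neg: "heat_weight t summable_on range (\<lambda>k. - int k)"
    using nat by (subst summable_on_reindex) (auto simp: o_def inj_on_def heat_weight_def)
  \<comment> \<open>Both halves contain 0, so the overlap is removed before uniting them.\<close>
  have neg': "heat_weight t summable_on range (\<lambda>k. - int k) - range int"
    by (rule summable_on_subset [OF neg]) auto
  have "heat_weight t summable_on range int \<union> (range (\<lambda>k. - int k) - range int)"
    using pos neg' by (rule summable_on_Un_disjoint) auto
  moreover have "n \<in> range int \<union> range (\<lambda>k. - int k)" for n
    by (cases n rule: int_cases2) auto
  then have "range int \<union> (range (\<lambda>k. - int k) - range int) = UNIV"
    by blast
  ultimately show ?thesis by simp
qed

definition heat_coeff :: "real \<Rightarrow> (real \<Rightarrow> complex) \<Rightarrow> int \<Rightarrow> complex" where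
  "heat_coeff t f n = of_real (heat_weight t n) * fourier_coeff f n"

lemma heat_op_eq: "heat_op t f x = (\<Sum>\<^sub>\<infinity>n\<in>UNIV. heat_coeff t f n * emode n x)"
  by (simp add: heat_op_def heat_coeff_def heat_weight_def emode_def)

lemma norm_heat_coeff: "f \<in> L2 \<Longrightarrow> norm (heat_coeff t f n) \<le> heat_weight t n * L2_norm f"
  by (simp add: heat_coeff_def norm_mult mult_left_mono fourier_coeff_bound)

lemma heat_coeff_diff:
  assumes "f \<in> L2" "g \<in> L2"
  shows "heat_coeff t (\<lambda>x. f x - g x) n = heat_coeff t f n - heat_coeff t g n"
  unfolding heat_coeff_def fourier_coeff_diff [OF assms] by (rule right_diff_distrib)

lemma heat_coeff_summable:
  assumes "0 < t" "f \<in> L2"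
  shows "(\<lambda>n. norm (heat_coeff t f n * emode n x)) summable_on UNIV"
  by (rule Infinite_Sum.abs_summable_on_comparison_test'
        [OF summable_on_cmult_left [OF summable_heat_weight [OF assms(1)], of "L2_norm f"]])
     (simp add: norm_mult norm_heat_coeff assms)

lemma heat_op_diff:
  assumes "0 < t" "f \<in> L2" "g \<in> L2"
  shows "heat_op t (\<lambda>x. f x - g x) x = heat_op t f x - heat_op t g x"
proof -
  have s: "(\<lambda>n. heat_coeff t u n * emode n x) summable_on UNIV" if "u \<in> L2" for u
    by (rule abs_summable_summable [OF heat_coeff_summable [OF assms(1) that]])
  have "((\<lambda>n. heat_coeff t f n * emode n x + - (heat_coeff t g n * emode n x))
      has_sum (heat_op t f x + - heat_op t g x)) UNIV"
    unfolding heat_op_eq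
    by (intro has_sum_add iffD2 [OF has_sum_uminus]; simp add: has_sum_infsum s assms)
  then have "((\<lambda>n. heat_coeff t (\<lambda>x. f x - g x) n * emode n x) has_sum (heat_op t f x - heat_op t g x)) UNIV"
    by (simp add: heat_coeff_diff [OF assms(2,3)] left_diff_distrib)
  then show ?thesis
    unfolding heat_op_eq by (rule infsumI)
qed

lemma heat_op_uniform_limit:
  assumes "0 < t" "f \<in> L2"
  shows "uniform_limit UNIV (\<lambda>F. trig F (heat_coeff t f)) (heat_op t f) (finite_subsets_at_top UNIV)"
proof -
  have "uniform_limit UNIV (\<lambda>F x. \<Sum>n\<in>F. heat_coeff t f n * emode n x)
      (\<lambda>x. \<Sum>\<^sub>\<infinity>n\<in>UNIV. heat_coeff t f n * emode n x) (finite_subsets_at_top UNIV)"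
    by (rule Weierstrass_m_test_general
          [OF _ summable_on_cmult_left [OF summable_heat_weight [OF assms(1)], of "L2_norm f"]])
       (simp add: norm_mult norm_heat_coeff assms)
  then show ?thesis
    by (simp add: trig_def [abs_def] heat_op_eq [abs_def])
qed

lemma heat_op_continuous:
  assumes "0 < t" "f \<in> L2"
  shows "continuous_on UNIV (heat_op t f)"
  by (rule uniform_limit_theorem [OF _ heat_op_uniform_limit [OF assms]])
     (auto simp: trig_def [abs_def] intro!: always_eventually continuous_intros)

text \<open>
  The low modes are controlled by the integral norm of \<open>heat_op t f\<close>, the high modes by \<open>L2_norm f\<close>.
  A quarter of the exponent is sacrificed to make the tail summable.
\<close>

lemma norm_heat_op_le:
  assumes t: "0 < t" and f: "f \<in> L2" and X: "0 \<le> X"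
    and L: "\<And>n. norm (heat_coeff t f n) \<le> L"
  shows "norm (heat_op t f x) \<le> (2 * X + 1) * L
    + exp (- (3 / 4 * X\<^sup>2 * t)) * infsum (heat_weight (t / 4)) UNIV * L2_norm f"
proof -
  define A where "A = {n::int. \<bar>of_int n\<bar> \<le> X}"
  have A_eq: "A = {-\<lfloor>X\<rfloor>..\<lfloor>X\<rfloor>}"
    unfolding A_def by (auto simp: le_floor_iff abs_le_iff minus_le_iff)
  have A: "finite A" "real (card A) \<le> 2 * X + 1"
    using X unfolding A_eq by (auto simp: of_nat_nat)
  let ?w = "infsum (heat_weight (t / 4)) UNIV" and ?E = "exp (- (3 / 4 * X\<^sup>2 * t))"
  let ?u = "\<lambda>n. heat_coeff t f n * emode n x"
  have L0: "0 \<le> L" using L [of 0] norm_ge_zero order_trans by blast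
  have w: "heat_weight (t / 4) summable_on B" for B
    using summable_on_subset [OF summable_heat_weight, of "t / 4" B] t by simp
  have abs: "(\<lambda>n. norm (?u n)) summable_on B" for B
    using summable_on_subset [OF heat_coeff_summable [OF t f]] by simp
  have u: "?u summable_on B" for B
    using abs by (rule abs_summable_summable)
  have tail: "norm (?u n) \<le> heat_weight (t / 4) n * (?E * L2_norm f)" if "n \<in> - A" for n
  proof -
    have "X \<le> \<bar>of_int n\<bar>" using that by (simp add: A_def)
    then have "X\<^sup>2 \<le> (of_int n)\<^sup>2"
      using X by (metis abs_of_nonneg abs_le_square_iff)
    then have "X\<^sup>2 * t \<le> (of_int n)\<^sup>2 * t"
      using t by simp
    then have "heat_weight t n \<le> heat_weight (t / 4) n * ?E"
      unfolding heat_weight_def exp_add [symmetric] by simp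
    then have "heat_weight t n * L2_norm f \<le> heat_weight (t / 4) n * ?E * L2_norm f"
      by (rule mult_right_mono) simp
    then show ?thesis
      using norm_heat_coeff [OF f, of t n] by (simp add: norm_mult mult.assoc)
  qed
  have "heat_op t f x = infsum ?u (A \<union> - A)"
    by (simp add: heat_op_eq)
  also have "\<dots> = sum ?u A + infsum ?u (- A)"
    using A(1) by (subst infsum_Un_disjoint [OF u u]) auto
  finally have "norm (heat_op t f x) \<le> norm (sum ?u A) + norm (infsum ?u (- A))"
    by (simp add: norm_triangle_ineq)
  also have "norm (sum ?u A) \<le> real (card A) * L"
    by (rule sum_norm_bound) (simp add: norm_mult L)
  also have "\<dots> \<le> (2 * X + 1) * L"
    using A(2) L0 by (rule mult_right_mono)
  also have "norm (infsum ?u (- A)) \<le> infsum (\<lambda>n. norm (?u n)) (- A)"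
    by (rule norm_infsum_bound [OF abs])
  also have "\<dots> \<le> infsum (\<lambda>n. heat_weight (t / 4) n * (?E * L2_norm f)) (- A)"
    by (intro infsum_mono abs summable_on_cmult_left w tail)
  also have "\<dots> = infsum (heat_weight (t / 4)) (- A) * (?E * L2_norm f)"
    by (rule infsum_cmult_left')
  also have "\<dots> \<le> ?w * (?E * L2_norm f)"
    by (intro mult_right_mono infsum_mono2 w) auto
  finally show ?thesis by (simp add: mult_ac)
qed

text \<open>Here the factor \<open>1 / (2 * pi)\<close> has to be kept: it determines how many low
  modes can be absorbed in \<open>energy_estimate\<close>.\<close>

lemma norm_fourier_coeff_le_L1:
  assumes "integrable per_measure g"
  shows "norm (fourier_coeff g n) \<le> L1_norm g / (2 * pi)"
proof -
  have "norm (LINT x|per_measure. g x * cnj (emode n x)) \<le> (LINT x|per_measure. norm (g x * cnj (emode n x)))"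
    by (rule integral_norm_bound)
  then show ?thesis
    unfolding fourier_coeff_eq by (simp add: norm_mult L1_norm_on_def field_simps)
qed

lemma norm_fourier_coeff_le_sup:
  assumes "g \<in> borel_measurable per_measure" and B: "\<And>x. x \<in> per \<Longrightarrow> norm (g x) \<le> B"
  shows "norm (fourier_coeff g n) \<le> B"
proof -
  have g: "integrable per_measure g"
    using assms by (rule bounded_integrable_per)
  have "L1_norm g \<le> (LINT x|per_measure. B)"
    unfolding L1_norm_on_def using g
    by (intro integral_mono integrable_norm bounded_integrable_per [of "\<lambda>_. B" "norm B"]) (auto intro: B)
  then show ?thesis
    using order_trans [OF norm_fourier_coeff_le_L1 [OF g, of n] divide_right_mono, of "2 * pi * B"]
    by (simp add: measure_per)
qed

lemma heat_op_L2:
  assumes "0 < t" "f \<in> L2"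
  shows "heat_op t f \<in> L2" "integrable per_measure (heat_op t f)"
proof -
  have m: "heat_op t f \<in> borel_measurable per_measure"
    using heat_op_continuous [OF assms] by (rule continuous_measurable_per)
  have "heat_weight t n \<le> 1" for n
    using assms(1) by (simp add: heat_weight_def)
  then have "norm (heat_coeff t f n) \<le> L2_norm f" for n
    using norm_heat_coeff [OF assms(2), of t n] by (meson L2_norm_nonneg mult_left_le_one_le heat_weight_pos order_trans)
  \<comment> \<open>Cutoff frequency 0 already gives a bound that is uniform in
    \<open>x\<close>.\<close>
  from norm_heat_op_le [OF assms order_refl this]
  obtain B where "\<And>x. norm (heat_op t f x) \<le> B" by blast
  then show "heat_op t f \<in> L2" "integrable per_measure (heat_op t f)"
    using m by (auto intro: L2_I_bounded bounded_integrable_per)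
qed

text \<open>A sup bound controls every coefficient, so coefficients pass to the uniform limit of the
  finite partial sums, where they can be read off once the frequency belongs to the index
  set.\<close>

lemma fourier_coeff_heat_op:
  assumes "0 < t" "f \<in> L2"
  shows "fourier_coeff (heat_op t f) n = heat_coeff t f n"
proof -
  have "norm (fourier_coeff (heat_op t f) n - heat_coeff t f n) \<le> 0 + e" if "0 < e" for e
  proof -
    have "eventually (\<lambda>F. \<forall>x. norm (trig F (heat_coeff t f) x - heat_op t f x) < e) (finite_subsets_at_top UNIV)"
      using uniform_limitD [OF heat_op_uniform_limit [OF assms] that] by (simp add: dist_norm)
    moreover have "eventually (\<lambda>F. finite F \<and> n \<in> F) (finite_subsets_at_top UNIV)"
      unfolding eventually_finite_subsets_at_top by (rule exI [of _ "{n}"]) auto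
    ultimately have "eventually (\<lambda>F. (\<forall>x. norm (trig F (heat_coeff t f) x - heat_op t f x) < e)
        \<and> finite F \<and> n \<in> F) (finite_subsets_at_top UNIV)"
      by (rule eventually_conj)
    then obtain F where F: "\<And>x. norm (trig F (heat_coeff t f) x - heat_op t f x) < e" "finite F" "n \<in> F"
      using eventually_happens' [OF finite_subsets_at_top_neq_bot] by blast
    have "norm (fourier_coeff (\<lambda>x. trig F (heat_coeff t f) x - heat_op t f x) n) \<le> e"
      using F(1) by (intro norm_fourier_coeff_le_sup L2_measurable L2_diff heat_op_L2 assms trig_L2) (simp add: less_imp_le)
    then show ?thesis
      using F(2,3) by (simp add: fourier_coeff_diff heat_op_L2 assms fourier_coeff_trig norm_minus_commute)
  qed
  then have "norm (fourier_coeff (heat_op t f) n - heat_coeff t f n) \<le> 0"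
    by (rule field_le_epsilon)
  then show ?thesis by simp
qed

text \<open>The only access from the data norm to individual modes; it serves both the sup bound on
  \<open>heat_op t h\<close> and the inversion of the damping at low frequencies.\<close>

lemma norm_heat_coeff_le_L1:
  assumes "0 < t" "f \<in> L2"
  shows "norm (heat_coeff t f n) \<le> L1_norm (heat_op t f) / (2 * pi)"
  using norm_fourier_coeff_le_L1 [OF heat_op_L2(2) [OF assms], of n]
  by (simp add: fourier_coeff_heat_op assms)

lemma L1_norm_nonneg [simp]: "0 \<le> L1_norm_on A g"
  by (simp add: L1_norm_on_def)

section \<open>Source condition, noise and minimality\<close>

text \<open>Splits the Fourier series of \<open>fdag\<close> at frequency \<open>sqrt R\<close>.\<close>

lemma logarithmic_source_condition:
  fixes fdag h :: "real \<Rightarrow> complex"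
  assumes t: "0 < t" and p: "0 < p" and fdag: "fdag \<in> sobolev p" and h: "h \<in> L2" and R: "0 < R"
  defines "S \<equiv> infsum (\<lambda>n::int. (1 + (of_int n)\<^sup>2) powr p * (norm (fourier_coeff fdag n))\<^sup>2) UNIV"
  shows "norm (LINT x|per_measure. h x * cnj (fdag x)) \<le>
    exp (2 * R * t) * infsum (heat_weight t) UNIV * L2_norm fdag * L1_norm (heat_op t h)
    + L2_norm h * sqrt (2 * pi * (R powr - p * S))"
proof -
  let ?c = "fourier_coeff fdag" and ?L = "L1_norm (heat_op t h)"
  have f2: "fdag \<in> L2" and sum_S: "(\<lambda>n::int. (1 + (of_int n)\<^sup>2) powr p * (norm (?c n))\<^sup>2) summable_on UNIV"
    using fdag by (auto simp: sobolev_def)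
  define A where "A = {n::int. (of_int n)\<^sup>2 \<le> R}"
  have "A \<subseteq> {-\<lceil>sqrt R\<rceil>..\<lceil>sqrt R\<rceil>}"
  proof
    fix n assume "n \<in> A"
    then have "\<bar>real_of_int n\<bar> \<le> sqrt R"
      unfolding A_def by (intro real_le_rsqrt) simp
    then show "n \<in> {-\<lceil>sqrt R\<rceil>..\<lceil>sqrt R\<rceil>}"
      by (auto simp: abs_le_iff) linarith+
  qed
  then have A: "finite A" by (rule finite_subset) simp
  have low_term: "norm (fourier_coeff h n * cnj (?c n)) \<le> ?L / (2 * pi) * (exp (2 * R * t) * (heat_weight t n * L2_norm fdag))"
    if "n \<in> A" for n
  proof -
    have "(of_int n)\<^sup>2 * t \<le> R * t" using that t by (simp add: A_def)
    \<comment> \<open>Undoing the damping would cost only \<open>exp (R * t)\<close>. Doubling the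
      exponent leaves a spare factor \<open>heat_weight t n\<close>, so the sum over
      \<open>A\<close> is bounded by a convergent series instead of by the number of modes.\<close>
    then have e: "exp ((of_int n)\<^sup>2 * t) \<le> exp (2 * R * t) * heat_weight t n"
      unfolding heat_weight_def exp_add [symmetric] by (simp add: algebra_simps)
    have "fourier_coeff h n = of_real (exp ((of_int n)\<^sup>2 * t)) * heat_coeff t h n"
      by (simp add: heat_coeff_def heat_weight_def exp_minus of_real_inverse field_simps)
    then have "norm (fourier_coeff h n) = exp ((of_int n)\<^sup>2 * t) * norm (heat_coeff t h n)"
      by (simp add: norm_mult)
    also have "\<dots> \<le> (exp (2 * R * t) * heat_weight t n) * (?L / (2 * pi))"
      using e norm_heat_coeff_le_L1 [OF t h] by (intro mult_mono) auto
    finally have "norm (fourier_coeff h n) * norm (?c n)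
        \<le> (exp (2 * R * t) * heat_weight t n) * (?L / (2 * pi)) * L2_norm fdag"
      using fourier_coeff_bound [OF f2, of n] by (intro mult_mono) auto
    then show ?thesis by (simp add: norm_mult mult_ac)
  qed
  have "norm (\<Sum>n\<in>A. fourier_coeff h n * cnj (?c n))
      \<le> (\<Sum>n\<in>A. ?L / (2 * pi) * (exp (2 * R * t) * (heat_weight t n * L2_norm fdag)))"
    by (rule sum_norm_le [OF low_term])
  also have "\<dots> = ?L / (2 * pi) * (exp (2 * R * t) * (sum (heat_weight t) A * L2_norm fdag))"
    by (simp add: sum_distrib_left sum_distrib_right)
  also have "\<dots> \<le> ?L / (2 * pi) * (exp (2 * R * t) * (infsum (heat_weight t) UNIV * L2_norm fdag))"
    using A by (intro mult_left_mono mult_right_mono finite_sum_le_infsum summable_heat_weight t) auto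
  finally have low: "norm (LINT x|per_measure. h x * cnj (trig A ?c x))
      \<le> exp (2 * R * t) * infsum (heat_weight t) UNIV * L2_norm fdag * ?L"
    unfolding inner_trig [OF h] by (simp add: norm_mult field_simps)
  let ?r = "\<lambda>x. fdag x - trig A ?c x"
  have r2: "?r \<in> L2" by (intro L2_diff f2 trig_L2)
  have "(L2_norm ?r)\<^sup>2 \<le> 2 * pi * (R powr - p * S)"
  proof (rule fourier_remainder_bound [OF f2 A])
    fix F :: "int set" assume F: "finite F" "F \<inter> A = {}"
    have "(norm (?c n))\<^sup>2 \<le> R powr - p * ((1 + (of_int n)\<^sup>2) powr p * (norm (?c n))\<^sup>2)" if "n \<in> F" for n
    proof -
      have "R \<le> 1 + (of_int n)\<^sup>2" using that F(2) by (force simp: A_def)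
      then have "R powr p \<le> (1 + (of_int n)\<^sup>2) powr p"
        using R p by (intro powr_mono2) auto
      then have "1 \<le> R powr - p * (1 + (of_int n)\<^sup>2) powr p"
        using R by (simp add: powr_minus field_simps)
      from mult_right_mono [OF this, of "(norm (?c n))\<^sup>2"] show ?thesis
        by (simp add: mult.assoc)
    qed
    then have "(\<Sum>n\<in>F. (norm (?c n))\<^sup>2)
        \<le> (\<Sum>n\<in>F. R powr - p * ((1 + (of_int n)\<^sup>2) powr p * (norm (?c n))\<^sup>2))"
      by (rule sum_mono)
    also have "\<dots> = R powr - p * (\<Sum>n\<in>F. (1 + (of_int n)\<^sup>2) powr p * (norm (?c n))\<^sup>2)"
      by (simp add: sum_distrib_left)
    also have "\<dots> \<le> R powr - p * S"
      unfolding S_def by (intro mult_left_mono finite_sum_le_infsum sum_S F) auto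
    finally show "(\<Sum>n\<in>F. (norm (?c n))\<^sup>2) \<le> R powr - p * S" .
  qed
  then have "L2_norm ?r \<le> sqrt (2 * pi * (R powr - p * S))"
    by (rule real_le_rsqrt)
  then have high: "norm (LINT x|per_measure. h x * cnj (?r x)) \<le> L2_norm h * sqrt (2 * pi * (R powr - p * S))"
    using L2_Cauchy_Schwarz [OF h r2] by (meson L2_norm_nonneg mult_left_mono order_trans)
  have "(LINT x|per_measure. h x * cnj (fdag x))
      = (LINT x|per_measure. h x * cnj (trig A ?c x) + h x * cnj (?r x))"
    by (simp add: algebra_simps)
  also have "\<dots> = (LINT x|per_measure. h x * cnj (trig A ?c x)) + (LINT x|per_measure. h x * cnj (?r x))"
    by (rule Bochner_Integration.integral_add
          [OF integrable_L2_mult [OF h trig_L2] integrable_L2_mult [OF h r2]])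
  also have "norm \<dots> \<le> norm (LINT x|per_measure. h x * cnj (trig A ?c x)) + norm (LINT x|per_measure. h x * cnj (?r x))"
    by (rule norm_triangle_ineq)
  finally show ?thesis
    using low high by linarith
qed

text \<open>
  On the exceptional set \<open>P\<close> the noise is arbitrary; there it enters the data misfits of \<open>f\<close> and
  \<open>fdag\<close> equally, up to the size of the smooth function \<open>heat_op t (f - fdag)\<close>.
\<close>

lemma minimizer_inequality:
  assumes t: "0 < t" and \<alpha>: "0 < \<alpha>" and fdag: "fdag \<in> L2" and \<xi>: "\<xi> \<in> L1"
    and noise: "impulsive_noise \<epsilon> \<eta> \<xi>"
    and min: "tikhonov_minimizer t \<alpha> (\<lambda>x. heat_op t fdag x + \<xi> x) f"
    and M: "\<And>x. norm (heat_op t (\<lambda>x. f x - fdag x) x) \<le> M"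
  shows "f \<in> L2"
    and "\<alpha> * ((L2_norm f)\<^sup>2 - (L2_norm fdag)\<^sup>2) + L1_norm (heat_op t (\<lambda>x. f x - fdag x)) \<le> 2 * \<epsilon> + 2 * \<eta> * M"
proof -
  show f: "f \<in> L2"
    using min by (simp add: tikhonov_minimizer_def is_arg_min_def)
  define g where "g = heat_op t (\<lambda>x. f x - fdag x)"
  have g: "integrable per_measure g"
    unfolding g_def by (intro heat_op_L2 t L2_diff f fdag)
  have g_eq: "g x = heat_op t f x - heat_op t fdag x" for x
    unfolding g_def by (rule heat_op_diff [OF t f fdag])
  have \<xi>: "integrable per_measure \<xi>"
    using \<xi> by (simp add: L1_def)
  have "tikhonov t \<alpha> (\<lambda>x. heat_op t fdag x + \<xi> x) f \<le> tikhonov t \<alpha> (\<lambda>x. heat_op t fdag x + \<xi> x) fdag"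
    using min fdag unfolding tikhonov_minimizer_def is_arg_min_def by force
  then have "L1_norm (\<lambda>x. g x - \<xi> x) / \<alpha> + (L2_norm f)\<^sup>2 \<le> L1_norm \<xi> / \<alpha> + (L2_norm fdag)\<^sup>2"
    by (simp add: tikhonov_def g_eq L1_norm_on_def algebra_simps)
  then have 1: "L1_norm (\<lambda>x. g x - \<xi> x) + \<alpha> * ((L2_norm f)\<^sup>2 - (L2_norm fdag)\<^sup>2) \<le> L1_norm \<xi>"
    using mult_left_mono [OF _ less_imp_le [OF \<alpha>]] \<alpha>
    by (fastforce simp: distrib_left right_diff_distrib)
  obtain P where P: "P \<in> sets borel" "P \<subseteq> per" "L1_norm_on (per - P) \<xi> \<le> \<epsilon>" "measure lborel P \<le> \<eta>"
    using noise unfolding impulsive_noise_def by blast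
  have P': "P \<in> sets per_measure" "per - P \<in> sets per_measure" "P \<in> sets lebesgue"
    using P(1,2) by (auto simp: sets_restrict_space_iff)
  have M0: "0 \<le> M" using M norm_ge_zero order_trans by blast
  have ind_g: "integrable per_measure (\<lambda>x. indicator P x * norm (g x))"
    using integrable_mult_indicator [OF P'(1) integrable_norm [OF g]] by simp
  have ind_\<xi>: "integrable per_measure (\<lambda>x. indicator (per - P) x * norm (\<xi> x))"
    using integrable_mult_indicator [OF P'(2) integrable_norm [OF \<xi>]] by simp
  have on_P: "(LINT x|per_measure. indicator P x * norm (g x)) \<le> \<eta> * M"
  proof -
    have "(LINT x|per_measure. indicator P x * norm (g x)) \<le> (LINT x|per_measure. indicator P x * M)"
    proof (rule integral_mono [OF ind_g])
      show "integrable per_measure (\<lambda>x. indicator P x * M)"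
        using P'(1) M0 by (intro bounded_integrable_per [of _ M]) (auto simp: indicator_def)
      show "indicator P x * norm (g x) \<le> indicator P x * M" for x
        using M by (auto simp: g_def indicator_def)
    qed
    also have "\<dots> = measure per_measure P * M"
      using P(2) by (simp add: Int_absorb2)
    also have "measure per_measure P = measure lborel P"
      using P by (simp add: measure_restrict_space)
    also have "\<dots> * M \<le> \<eta> * M"
      using P(4) M0 by (rule mult_right_mono)
    finally show ?thesis .
  qed
  have off_P: "(LINT x|per_measure. indicator (per - P) x * norm (\<xi> x)) = L1_norm_on (per - P) \<xi>"
  proof -
    have "per - P \<in> sets lebesgue" using P'(3) by auto
    then show ?thesis
      unfolding L1_norm_on_def
      by (simp add: integral_restrict_space) (rule Bochner_Integration.integral_cong, auto simp: indicator_def)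
  qed
  \<comment> \<open>The reverse triangle inequality is used in two ways: on \<open>P\<close> the
    misfit may drop by the size of \<open>g x\<close>, whatever the noise, and off \<open>P\<close>
    by the size of \<open>\<xi> x\<close>.\<close>
  have "norm (g x) \<le> norm (g x - \<xi> x) - norm (\<xi> x)
      + 2 * (indicator P x * norm (g x)) + 2 * (indicator (per - P) x * norm (\<xi> x))" if "x \<in> per" for x
    using that norm_triangle_ineq2 [of "\<xi> x" "g x"] norm_triangle_ineq2 [of "g x" "\<xi> x"]
    by (auto simp: indicator_def norm_minus_commute)
  then have "L1_norm g \<le> (LINT x|per_measure. norm (g x - \<xi> x) - norm (\<xi> x)
      + 2 * (indicator P x * norm (g x)) + 2 * (indicator (per - P) x * norm (\<xi> x)))"
    unfolding L1_norm_on_def using g \<xi> ind_g ind_\<xi> by (intro integral_mono) auto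
  also have "\<dots> = L1_norm (\<lambda>x. g x - \<xi> x) - L1_norm \<xi>
      + 2 * (LINT x|per_measure. indicator P x * norm (g x))
      + 2 * (LINT x|per_measure. indicator (per - P) x * norm (\<xi> x))"
  proof -
    define a b c d where "a x = norm (g x - \<xi> x)" and "b x = norm (\<xi> x)"
      and "c x = indicator P x * norm (g x)" and "d x = indicator (per - P) x * norm (\<xi> x)" for x
    have "integrable per_measure a" "integrable per_measure b" "integrable per_measure c" "integrable per_measure d"
      using g \<xi> ind_g ind_\<xi> by (auto simp: a_def [abs_def] b_def [abs_def] c_def [abs_def] d_def [abs_def])
    then have "(LINT x|per_measure. a x - b x + 2 * c x + 2 * d x)
      = integral\<^sup>L per_measure a - integral\<^sup>L per_measure b + 2 * integral\<^sup>L per_measure c + 2 * integral\<^sup>L per_measure d"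
      by simp
    then show ?thesis
      unfolding a_def [abs_def] b_def [abs_def] c_def [abs_def] d_def [abs_def] L1_norm_on_def .
  qed
  also have "\<dots> \<le> L1_norm (\<lambda>x. g x - \<xi> x) - L1_norm \<xi> + 2 * (\<eta> * M) + 2 * \<epsilon>"
    using on_P off_P P(3) by simp
  finally show "\<alpha> * ((L2_norm f)\<^sup>2 - (L2_norm fdag)\<^sup>2) + L1_norm (heat_op t (\<lambda>x. f x - fdag x)) \<le> 2 * \<epsilon> + 2 * \<eta> * M"
    using 1 by (simp add: g_def)
qed

text \<open>Weighted so that the two applications, to the source term and to the high-frequency
  tail, together use up half of the squared error norm.\<close>

lemma two_mult_le_quarter: "2 * (x * y) \<le> x\<^sup>2 / 4 + 4 * y\<^sup>2" for x y :: real
  using zero_le_power2 [of "x / 2 - 2 * y"] by (simp add: power2_eq_square algebra_simps)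

lemma powr_minus_quotient: "(x / y) powr - p = x powr - p * y powr p" for x y p :: real
  unfolding powr_minus powr_divide by (simp add: divide_inverse)

text \<open>With \<open>R = - ln \<alpha> / (4 * t)\<close> the low modes cost only
  \<open>exp (2 * R * t) = 1 / sqrt \<alpha>\<close>. For small \<alpha> this is absorbed into a
  fixed fraction of \<open>1 / \<alpha>\<close>, while \<open>R powr - p\<close> is a multiple of
  the logarithmic rate. For the remaining \<alpha> that rate is bounded below, and a large constant
  does the rest.\<close>

lemma source_condition_absorbed:
  fixes fdag :: "real \<Rightarrow> complex"
  assumes t: "0 < t" and p: "0 < p" and fdag: "fdag \<in> sobolev p"
  shows "\<exists>C\<ge>0. \<forall>\<alpha> h. 0 < \<alpha> \<and> \<alpha> < 1 \<and> h \<in> L2 \<longrightarrow>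
    2 * norm (LINT x|per_measure. h x * cnj (fdag x)) \<le>
      L1_norm (heat_op t h) / (6 * \<alpha>) + (L2_norm h)\<^sup>2 / 4 + C * log_rate p \<alpha>"
proof -
  define S where "S = infsum (\<lambda>n::int. (1 + (of_int n)\<^sup>2) powr p * (norm (fourier_coeff fdag n))\<^sup>2) UNIV"
  define W where "W = infsum (heat_weight t) UNIV"
  define N where "N = L2_norm fdag"
  \<comment> \<open>Absorption requires \<open>12 * W * N * sqrt \<alpha> \<le> 1\<close>. The
    summand 1 keeps the denominator positive, and the factor 2 ensures \<open>\<alpha>0 < 1\<close>,
    so that \<open>ln \<alpha>0\<close> is negative.\<close>
  define \<alpha>0 where "\<alpha>0 = 1 / (2 * (12 * W * N + 1)\<^sup>2)"
  \<comment> \<open>The first summand stems from the high modes for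
    \<open>\<alpha> \<le> \<alpha>0\<close>, the second from the range above
    \<open>\<alpha>0\<close>.\<close>
  define C where "C = 8 * pi * S * (4 * t) powr p + 4 * N\<^sup>2 * (- ln \<alpha>0) powr p"
  have f2: "fdag \<in> L2" using fdag by (simp add: sobolev_def)
  have S: "0 \<le> S" unfolding S_def by (intro infsum_nonneg) simp
  have W: "0 \<le> W" unfolding W_def by (intro infsum_nonneg) simp
  have N: "0 \<le> N" by (simp add: N_def)
  have WN: "0 \<le> W * N" using W N by simp
  have "1 \<le> (12 * W * N + 1)\<^sup>2"
    using W N by (intro one_le_power) simp
  moreover have "0 < 1 / (2 * y) \<and> 1 / (2 * y) < 1" if "1 \<le> y" for y :: real
    using that by (simp add: divide_less_eq)
  ultimately have \<alpha>0: "0 < \<alpha>0" "\<alpha>0 < 1"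
    unfolding \<alpha>0_def by blast+
  have C0: "0 \<le> C" unfolding C_def using S by simp
  have "2 * norm (LINT x|per_measure. h x * cnj (fdag x)) \<le>
      L1_norm (heat_op t h) / (6 * \<alpha>) + (L2_norm h)\<^sup>2 / 4 + C * log_rate p \<alpha>"
    if \<alpha>: "0 < \<alpha>" "\<alpha> < 1" and h: "h \<in> L2" for \<alpha> h
  proof (cases "\<alpha> \<le> \<alpha>0")
    case True
    define R where "R = (- ln \<alpha>) / (4 * t)"
    have R: "0 < R" using \<alpha> t by (simp add: R_def divide_neg_pos)
    have "exp (2 * R * t) = exp (- (ln \<alpha> / 2))"
      using t by (simp add: R_def)
    also have "\<dots> = 1 / sqrt \<alpha>"
      using \<alpha> by (simp add: exp_minus ln_sqrt [symmetric] field_simps)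
    finally have eR: "exp (2 * R * t) = 1 / sqrt \<alpha>" .
    have "\<alpha> \<le> (1 / (12 * W * N + 1))\<^sup>2"
      using True WN unfolding \<alpha>0_def power_divide by (simp add: field_simps)
    moreover define s where "s = sqrt \<alpha>"
    ultimately have "s \<le> 1 / (12 * W * N + 1)"
      using WN by (intro real_le_lsqrt [of _ \<alpha>, folded s_def]) auto
    then have "s * (12 * W * N + 1) \<le> 1"
      using WN by (simp add: field_simps)
    moreover have s: "0 < s" "\<alpha> = s * s"
      using \<alpha> by (simp_all add: s_def)
    ultimately have "2 * (W * N) * (6 * s) \<le> 1"
      by (simp add: algebra_simps)
    then have "2 * (W * N) \<le> 1 / (6 * s)"
      using s by (simp add: pos_le_divide_eq)
    from mult_left_mono [OF this, of "1 / s"]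
    have "2 * (1 / sqrt \<alpha> * (W * N)) \<le> 1 / (6 * \<alpha>)"
      using s by (simp add: s_def [symmetric])
    from mult_right_mono [OF this, of "L1_norm (heat_op t h)"]
    have low: "2 * (exp (2 * R * t) * W * N * L1_norm (heat_op t h)) \<le> L1_norm (heat_op t h) / (6 * \<alpha>)"
      unfolding eR by (simp add: mult.assoc)
    have "R powr - p = (4 * t) powr p * log_rate p \<alpha>"
      unfolding R_def using \<alpha> t by (subst powr_minus_quotient) (auto simp: log_rate_def)
    moreover have lr: "0 \<le> log_rate p \<alpha>" by (simp add: log_rate_def)
    ultimately have Q: "4 * (sqrt (2 * pi * (R powr - p * S)))\<^sup>2 = 8 * pi * S * (4 * t) powr p * log_rate p \<alpha>"
      using S by simp
    have "8 * pi * S * (4 * t) powr p * log_rate p \<alpha> \<le> C * log_rate p \<alpha>"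
      unfolding C_def by (intro mult_right_mono lr) simp
    then show ?thesis
      using logarithmic_source_condition [OF t p fdag h R] low Q
        two_mult_le_quarter [of "L2_norm h" "sqrt (2 * pi * (R powr - p * S))"]
      unfolding S_def W_def N_def by linarith
  next
    case False
    \<comment> \<open>Above \<open>\<alpha>0\<close> the rate is at least
      \<open>(- ln \<alpha>0) powr - p\<close>, so plain Cauchy-Schwarz is enough.\<close>
    then have "ln \<alpha>0 < ln \<alpha>" using \<alpha>0 by simp
    then have "(- ln \<alpha>) powr p \<le> (- ln \<alpha>0) powr p"
      using \<alpha> p by (intro powr_mono2) auto
    then have "1 \<le> (- ln \<alpha>0) powr p * log_rate p \<alpha>"
      using \<alpha> by (simp add: log_rate_def powr_minus field_simps)
    from mult_left_mono [OF this, of "4 * N\<^sup>2"]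
    have "4 * N\<^sup>2 \<le> 4 * N\<^sup>2 * (- ln \<alpha>0) powr p * log_rate p \<alpha>"
      by (simp add: mult.assoc)
    also have "\<dots> \<le> C * log_rate p \<alpha>"
      unfolding C_def using S by (intro mult_right_mono) (auto simp: log_rate_def)
    finally have "4 * N\<^sup>2 \<le> C * log_rate p \<alpha>" .
    moreover have "0 \<le> L1_norm (heat_op t h) / (6 * \<alpha>)" using \<alpha> by simp
    ultimately show ?thesis
      using L2_Cauchy_Schwarz [OF h f2] two_mult_le_quarter [of "L2_norm h" N] unfolding N_def by linarith
  qed
  then show ?thesis using C0 by blast
qed

text \<open>
  The cutoff frequency \<open>3 * pi / (10 * \<eta>)\<close> is small enough for the low modes on the exceptional set
  to be absorbed into the left-hand side, yet large enough for the exponent \<open>27 / 200\<close> of the squared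
  tail to exceed the \<open>1 / 8\<close> of the theorem; the surplus pays for all powers of \<open>\<eta>\<close>.
\<close>

lemma energy_estimate:
  fixes fdag :: "real \<Rightarrow> complex"
  assumes t: "0 < t" and p: "0 < p" and fdag: "fdag \<in> sobolev p"
  shows "\<exists>K>0. \<forall>\<eta> \<epsilon> \<alpha> \<xi> f. 0 < \<eta> \<and> \<eta> \<le> 1 / 5 \<and> 0 \<le> \<epsilon> \<and> 0 < \<alpha> \<and> \<alpha> < 1 \<and> \<xi> \<in> L1 \<and>
      impulsive_noise \<epsilon> \<eta> \<xi> \<and> tikhonov_minimizer t \<alpha> (\<lambda>x. heat_op t fdag x + \<xi> x) f \<longrightarrow>
    (L2_norm (\<lambda>x. f x - fdag x))\<^sup>2 + L1_norm (\<lambda>x. heat_op t f x - heat_op t fdag x) / \<alpha> \<le>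
      K * (\<epsilon> / \<alpha> + \<eta>\<^sup>2 / \<alpha>\<^sup>2 * exp (- (27 * pi\<^sup>2 / (200 * \<eta>\<^sup>2)) * t) + log_rate p \<alpha>)"
proof -
  obtain C where C: "0 \<le> C" and source: "\<And>\<alpha> h. 0 < \<alpha> \<Longrightarrow> \<alpha> < 1 \<Longrightarrow> h \<in> L2 \<Longrightarrow>
    2 * norm (LINT x|per_measure. h x * cnj (fdag x)) \<le>
      L1_norm (heat_op t h) / (6 * \<alpha>) + (L2_norm h)\<^sup>2 / 4 + C * log_rate p \<alpha>"
    using source_condition_absorbed [OF assms] by blast
  define B where "B = infsum (heat_weight (t / 4)) UNIV"
  \<comment> \<open>Six times the coefficients 2, \<open>4 * B\<^sup>2\<close> and \<open>C\<close>
    of the final inequality; the factor 6 clears the term \<open>L / (6 * \<alpha>)\<close>.\<close>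
  define K where "K = 12 + 24 * B\<^sup>2 + 6 * C"
  have f2: "fdag \<in> L2" using fdag by (simp add: sobolev_def)
  have "(L2_norm (\<lambda>x. f x - fdag x))\<^sup>2 + L1_norm (\<lambda>x. heat_op t f x - heat_op t fdag x) / \<alpha> \<le>
      K * (\<epsilon> / \<alpha> + \<eta>\<^sup>2 / \<alpha>\<^sup>2 * exp (- (27 * pi\<^sup>2 / (200 * \<eta>\<^sup>2)) * t) + log_rate p \<alpha>)"
    if \<eta>: "0 < \<eta>" "\<eta> \<le> 1 / 5" and \<epsilon>: "0 \<le> \<epsilon>" and \<alpha>: "0 < \<alpha>" "\<alpha> < 1" and \<xi>: "\<xi> \<in> L1"
      and noise: "impulsive_noise \<epsilon> \<eta> \<xi>" and min: "tikhonov_minimizer t \<alpha> (\<lambda>x. heat_op t fdag x + \<xi> x) f"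
    for \<eta> \<epsilon> \<alpha> \<xi> f
  proof -
    have f: "f \<in> L2"
      using min by (simp add: tikhonov_minimizer_def is_arg_min_def)
    define h where "h = (\<lambda>x. f x - fdag x)"
    have h: "h \<in> L2" unfolding h_def by (rule L2_diff [OF f f2])
    define L where "L = L1_norm (heat_op t h)"
    define n where "n = L2_norm h"
    define lr where "lr = log_rate p \<alpha>"
    define I where "I = (LINT x|per_measure. h x * cnj (fdag x))"
    define X where "X = 3 * pi / (10 * \<eta>)"
    define E where "E = exp (- (3 / 4 * X\<^sup>2 * t))"
    define M where "M = (2 * X + 1) * (L / (2 * pi)) + E * B * n"
    define y where "y = \<eta> * E * B / \<alpha>"
    have L: "L1_norm (\<lambda>x. heat_op t f x - heat_op t fdag x) = L" "0 \<le> L"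
      by (simp_all add: L_def h_def heat_op_diff [OF t f f2, abs_def])
    have lr: "0 \<le> lr" by (simp add: lr_def log_rate_def)
    have X: "0 \<le> X" using \<eta> by (simp add: X_def)
    have M: "norm (heat_op t (\<lambda>x. f x - fdag x) x) \<le> M" for x
      using norm_heat_op_le [OF t h X norm_heat_coeff_le_L1 [OF t h], of x]
      by (simp add: M_def L_def n_def E_def B_def h_def)
    have basic: "\<alpha> * ((L2_norm f)\<^sup>2 - (L2_norm fdag)\<^sup>2) + L \<le> 2 * \<epsilon> + 2 * \<eta> * M"
      using minimizer_inequality(2) [OF t \<alpha>(1) f2 \<xi> noise min M] by (simp add: L_def h_def)
    have expand: "(L2_norm f)\<^sup>2 = n\<^sup>2 + 2 * Re I + (L2_norm fdag)\<^sup>2"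
      using L2_norm_add_sq [OF h f2] by (simp add: h_def n_def I_def)
    have cross: "- (2 * Re I) \<le> L / (6 * \<alpha>) + n\<^sup>2 / 4 + C * lr"
      using source [OF \<alpha> h] abs_Re_le_cmod [of I] unfolding I_def L_def n_def lr_def by linarith
    \<comment> \<open>The part \<open>2 * X\<close> of the mode count yields 3 / 5, and the extra
      mode yields \<open>\<eta> / pi\<close>, at most 1 / 15 for \<open>\<eta> \<le> 1 / 5\<close>.
      Their sum is at most 2 / 3, so a third of \<open>L\<close> survives.\<close>
    have "2 * \<eta> * ((2 * X + 1) * (L / (2 * pi))) = (3 / 5 + \<eta> / pi) * L"
      using \<eta> by (simp add: X_def field_simps)
    also have "\<dots> \<le> 2 / 3 * L"
    proof (rule mult_right_mono [OF _ L(2)])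
      have "\<eta> / pi \<le> (1 / 5) / 3"
        using \<eta> pi_gt3 by (intro frac_le) auto
      then show "3 / 5 + \<eta> / pi \<le> 2 / 3" by linarith
    qed
    finally have absorb: "2 * \<eta> * M \<le> 2 / 3 * L + 2 * \<eta> * E * B * n"
      by (simp add: M_def distrib_left mult.assoc)
    have "\<alpha> * (n\<^sup>2 + 2 * Re I) + L / 3 \<le> 2 * \<epsilon> + 2 * \<eta> * E * B * n"
      using basic absorb unfolding expand by simp
    then have "(\<alpha> * (n\<^sup>2 + 2 * Re I) + L / 3) / \<alpha> \<le> (2 * \<epsilon> + 2 * \<eta> * E * B * n) / \<alpha>"
      using \<alpha> by (intro divide_right_mono) auto
    then have "n\<^sup>2 + 2 * Re I + L / (3 * \<alpha>) \<le> 2 * \<epsilon> / \<alpha> + 2 * (n * y)"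
      using \<alpha> by (simp add: add_divide_distrib y_def mult_ac)
    \<comment> \<open>One half of the surviving data term pays for the source condition; the other
      half is kept for the data error.\<close>
    moreover have "L / (3 * \<alpha>) = L / (6 * \<alpha>) + L / (6 * \<alpha>)"
      using \<alpha> by (simp add: field_simps)
    ultimately have "n\<^sup>2 / 2 + L / (6 * \<alpha>) \<le> 2 * \<epsilon> / \<alpha> + 4 * y\<^sup>2 + C * lr"
      using cross two_mult_le_quarter [of n y] by linarith
    moreover have "L / (6 * \<alpha>) = (L / \<alpha>) / 6" "2 * \<epsilon> / \<alpha> = 2 * (\<epsilon> / \<alpha>)" by simp_all
    ultimately have sum: "n\<^sup>2 + L / \<alpha> \<le> 12 * (\<epsilon> / \<alpha>) + 24 * y\<^sup>2 + 6 * (C * lr)"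
      using zero_le_power2 [of n] by linarith
    have "E\<^sup>2 = exp (- (27 * pi\<^sup>2 / (200 * \<eta>\<^sup>2)) * t)"
      unfolding E_def exp_double [symmetric] X_def by (simp add: power2_eq_square field_simps)
    then have y2: "y\<^sup>2 = B\<^sup>2 * (\<eta>\<^sup>2 / \<alpha>\<^sup>2 * exp (- (27 * pi\<^sup>2 / (200 * \<eta>\<^sup>2)) * t))"
      by (simp add: y_def power_mult_distrib power_divide mult_ac)
    define z where "z = \<eta>\<^sup>2 / \<alpha>\<^sup>2 * exp (- (27 * pi\<^sup>2 / (200 * \<eta>\<^sup>2)) * t)"
    have z: "0 \<le> z" by (simp add: z_def)
    have "12 * (\<epsilon> / \<alpha>) + 24 * (B\<^sup>2 * z) + 6 * (C * lr) \<le> K * (\<epsilon> / \<alpha>) + K * z + K * lr"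
    proof -
      have "0 \<le> \<epsilon> / \<alpha>" using \<epsilon> \<alpha> by simp
      moreover have "12 \<le> K" "24 * B\<^sup>2 \<le> K" "6 * C \<le> K"
        using C unfolding K_def by simp_all
      ultimately have "12 * (\<epsilon> / \<alpha>) \<le> K * (\<epsilon> / \<alpha>)" "24 * B\<^sup>2 * z \<le> K * z" "6 * C * lr \<le> K * lr"
        using z lr by (blast intro: mult_right_mono)+
      then show ?thesis by simp
    qed
    then show ?thesis
      using sum y2 unfolding L(1) n_def [symmetric, unfolded h_def] z_def [symmetric] lr_def [symmetric]
      by (simp add: distrib_left n_def h_def)
  qed
  moreover have "0 < K" using C by (simp add: K_def add_pos_nonneg)
  ultimately show ?thesis by blast
qed

section \<open>The parameter choice\<close>

text \<open>The level \<epsilon> may be zero while \<eta> is positive. A right-hand limit says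
  nothing at \<open>\<epsilon> = 0\<close>, hence the separate assumption
  \<open>P 0\<close>.\<close>

lemma eventually_noise_levels:
  fixes P Q :: "real \<Rightarrow> bool"
  assumes "eventually P (at_right 0)" "P 0" "eventually Q (at_right 0)"
  shows "\<forall>\<^sub>F (\<epsilon>, \<eta>) in at (0, 0) within {0..} \<times> {0<..}. 0 \<le> \<epsilon> \<and> 0 < \<eta> \<and> P \<epsilon> \<and> Q \<eta>"
proof -
  obtain a b where a: "0 < a" "\<And>x. 0 < x \<Longrightarrow> x < a \<Longrightarrow> P x" and b: "0 < b" "\<And>x. 0 < x \<Longrightarrow> x < b \<Longrightarrow> Q x"
    using assms(1,3) unfolding eventually_at_right_field by blast
  have "case z of (\<epsilon>, \<eta>) \<Rightarrow> 0 \<le> \<epsilon> \<and> 0 < \<eta> \<and> P \<epsilon> \<and> Q \<eta>"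
    if "z \<in> {0..} \<times> {0<..}" "dist z (0, 0) < min a b" for z
  proof -
    obtain \<epsilon> \<eta> where z: "z = (\<epsilon>, \<eta>)" by (cases z)
    have "\<bar>\<epsilon>\<bar> < a" "\<bar>\<eta>\<bar> < b"
      using that(2) dist_fst_le [of z "(0, 0)"] dist_snd_le [of z "(0, 0)"] by (auto simp: z)
    then show ?thesis
      using that(1) a(2) [of \<epsilon>] b(2) [of \<eta>] assms(2) by (cases "\<epsilon> = 0") (auto simp: z)
  qed
  then show ?thesis
    unfolding eventually_at using a(1) b(1) by (intro exI [of _ "min a b"]) auto
qed

lemma log_rate_nonneg: "0 \<le> log_rate p s"
  by (simp add: log_rate_def)

text \<open>Removes the floor at the price of one unit in the frequency. The bound on \<eta> keeps
  the shifted frequency nonnegative, so that squaring is monotone.\<close>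

lemma gam_le:
  assumes t: "0 < t" and \<eta>: "0 < \<eta>" "\<eta> \<le> 1 / 5"
  shows "gam t (2 * \<eta>) \<le> 8 * max 1 (t powr (- 1 / 2)) / (exp (3 * t) - 1)
     * exp (- (pi / (2 * \<eta>) - 3 / 2)\<^sup>2 * t)"
proof -
  have "3 / 2 \<le> pi / (2 * \<eta>)"
    using \<eta> pi_gt3 by (simp add: field_simps)
  moreover have "pi / (2 * \<eta>) - 3 / 2 \<le> of_int \<lfloor>pi / (2 * \<eta>) - 1 / 2\<rfloor>"
    by linarith
  ultimately have "(pi / (2 * \<eta>) - 3 / 2)\<^sup>2 \<le> (of_int \<lfloor>pi / (2 * \<eta>) - 1 / 2\<rfloor>)\<^sup>2"
    by (intro power_mono) auto
  then have "exp (- (of_int \<lfloor>pi / (2 * \<eta>) - 1 / 2\<rfloor>)\<^sup>2 * t) \<le> exp (- (pi / (2 * \<eta>) - 3 / 2)\<^sup>2 * t)"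
    using t by simp
  moreover have "0 \<le> 8 * max 1 (t powr (- 1 / 2)) / (exp (3 * t) - 1)"
    using t by (intro divide_nonneg_nonneg) auto
  ultimately show ?thesis
    unfolding gam_def by (rule mult_left_mono)
qed

text \<open>The maximum of two balances. The second entry turns \<open>\<epsilon> / \<alpha>\<close>
  into the logarithmic rate of \<epsilon>. The first has a logarithm of order
  \<open>- 1 / \<eta>\<^sup>2\<close>, hence logarithmic rate of order
  \<open>\<eta> powr (2 * p)\<close>, and is just large enough to control the squared tail. At
  \<open>\<epsilon> = 0\<close> the second entry is 0.\<close>

definition alpha_choice :: "real \<Rightarrow> real \<Rightarrow> real \<Rightarrow> real \<Rightarrow> real" where
  "alpha_choice t p \<epsilon> \<eta> = max (\<eta> * exp (- (pi\<^sup>2 / (16 * \<eta>\<^sup>2)) * t)) (\<epsilon> * (- ln \<epsilon>) powr p)"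

text \<open>Guarded so that 0 qualifies. The conditions keep the second entry of the parameter below
  1, compare its logarithm with that of \<epsilon>, and reserve half of \<open>Ce\<close> for the
  noise summand of admissibility.\<close>

definition small_eps :: "real \<Rightarrow> real \<Rightarrow> real \<Rightarrow> bool" where
  "small_eps p Ce \<epsilon> \<longleftrightarrow> (0 < \<epsilon> \<longrightarrow> \<epsilon> < 1 \<and> \<epsilon> * (- ln \<epsilon>) powr p < 1 \<and>
     - ln \<epsilon> / 2 \<le> - ln (\<epsilon> * (- ln \<epsilon>) powr p) \<and> 2 * (- ln \<epsilon>) powr - p \<le> (Ce / 2)\<^sup>2)"

text \<open>The middle condition reserves the other half of \<open>Ce\<close> for the summand with
  \<open>gam\<close>. In the last one, 1 / 100 is the surplus of 27 / 200 over 2 / 16.\<close>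

definition small_eta :: "real \<Rightarrow> real \<Rightarrow> real \<Rightarrow> real \<Rightarrow> bool" where
  "small_eta t p Ce \<eta> \<longleftrightarrow> \<eta> \<le> 1 / 5 \<and>
     2 * (8 * max 1 (t powr (- 1 / 2)) / (exp (3 * t) - 1)) *
       exp (- (pi / (2 * \<eta>) - 3 / 2)\<^sup>2 * t + pi\<^sup>2 / (16 * \<eta>\<^sup>2) * t) \<le> Ce / 2 \<and>
     exp (- (pi\<^sup>2 / (100 * \<eta>\<^sup>2)) * t) \<le> \<eta> powr (2 * p)"

lemma eventually_small_eps:
  assumes "0 < p" "0 < Ce"
  shows "eventually (small_eps p Ce) (at_right 0)"
proof -
  have "eventually (\<lambda>\<epsilon>. \<epsilon> < (1::real)) (at_right 0)" by real_asymp
  moreover have "((\<lambda>\<epsilon>::real. \<epsilon> * (- ln \<epsilon>) powr p) \<longlongrightarrow> 0) (at_right 0)"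
    using assms(1) by real_asymp
  then have "eventually (\<lambda>\<epsilon>::real. \<epsilon> * (- ln \<epsilon>) powr p < 1) (at_right 0)"
    by (rule order_tendstoD) simp
  moreover have "eventually (\<lambda>\<epsilon>::real. - ln \<epsilon> / 2 \<le> - ln (\<epsilon> * (- ln \<epsilon>) powr p)) (at_right 0)"
    using assms(1) by real_asymp
  moreover have "((\<lambda>\<epsilon>::real. 2 * (- ln \<epsilon>) powr - p) \<longlongrightarrow> 0) (at_right 0)"
    using assms(1) by real_asymp
  then have "eventually (\<lambda>\<epsilon>::real. 2 * (- ln \<epsilon>) powr - p < (Ce / 2)\<^sup>2) (at_right 0)"
    by (rule order_tendstoD) (use assms(2) in simp)
  ultimately show ?thesis
    by eventually_elim (auto simp: small_eps_def)
qed

lemma eventually_small_eta: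
  assumes "0 < t" "0 < p" "0 < Ce"
  shows "eventually (small_eta t p Ce) (at_right 0)"
proof -
  define G where "G = 2 * (8 * max 1 (t powr (- 1 / 2)) / (exp (3 * t) - 1))"
  have "eventually (\<lambda>\<eta>. \<eta> \<le> (1 / 5 :: real)) (at_right 0)" by real_asymp
  moreover have "((\<lambda>\<eta>::real. exp (- (pi / (2 * \<eta>) - 3 / 2)\<^sup>2 * t + pi\<^sup>2 / (16 * \<eta>\<^sup>2) * t)) \<longlongrightarrow> 0) (at_right 0)"
  proof (rule Lim_transform_eventually)
    \<comment> \<open>Expanding the square, the leading coefficient is
      \<open>- 1 / 4 + 1 / 16 = - 3 / 16\<close>; being negative, it dominates the cross term of
      order \<open>1 / \<eta>\<close>.\<close>
    define c where "c = 3 / 16 * (pi\<^sup>2 * t)"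
    have "0 < c" using assms(1) by (simp add: c_def)
    then show "((\<lambda>\<eta>::real. exp (- c / \<eta>\<^sup>2 + 3 / 2 * (pi * t) / \<eta> - 9 / 4 * t)) \<longlongrightarrow> 0) (at_right 0)"
      by real_asymp
    show "\<forall>\<^sub>F \<eta>::real in at_right 0. exp (- c / \<eta>\<^sup>2 + 3 / 2 * (pi * t) / \<eta> - 9 / 4 * t)
        = exp (- (pi / (2 * \<eta>) - 3 / 2)\<^sup>2 * t + pi\<^sup>2 / (16 * \<eta>\<^sup>2) * t)"
      using eventually_at_right_less [of 0]
    proof eventually_elim
      case (elim \<eta>)
      have "- c / \<eta>\<^sup>2 + 3 / 2 * (pi * t) / \<eta> - 9 / 4 * t
          = - (pi / (2 * \<eta>) - 3 / 2)\<^sup>2 * t + pi\<^sup>2 / (16 * \<eta>\<^sup>2) * t"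
        using elim by (simp add: c_def divide_simps power2_diff) (simp add: power2_eq_square algebra_simps)
      then show ?case by (rule arg_cong)
    qed
  qed
  from tendsto_mult_right_zero [OF this, of G]
  have "eventually (\<lambda>\<eta>::real. G * exp (- (pi / (2 * \<eta>) - 3 / 2)\<^sup>2 * t + pi\<^sup>2 / (16 * \<eta>\<^sup>2) * t) < Ce / 2) (at_right 0)"
    by (rule order_tendstoD) (use assms(3) in simp)
  moreover have "eventually (\<lambda>\<eta>::real. exp (- (pi\<^sup>2 / (100 * \<eta>\<^sup>2)) * t) \<le> \<eta> powr (2 * p)) (at_right 0)"
    using assms(1,2) by real_asymp
  ultimately show ?thesis
    by eventually_elim (auto simp: small_eta_def G_def)
qed

lemma alpha_choice_tendsto:
  assumes t: "0 < t" and p: "0 < p"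
  shows "((\<lambda>(\<epsilon>, \<eta>). alpha_choice t p \<epsilon> \<eta>) \<longlongrightarrow> 0) (at (0, 0) within {0..} \<times> {0<..})"
proof (rule tendstoI)
  fix e :: real assume e: "0 < e"
  have "((\<lambda>\<epsilon>::real. \<epsilon> * (- ln \<epsilon>) powr p) \<longlongrightarrow> 0) (at_right 0)"
    using p by real_asymp
  then have "eventually (\<lambda>\<epsilon>::real. \<epsilon> * (- ln \<epsilon>) powr p < e) (at_right 0)"
    by (rule order_tendstoD) (rule e)
  moreover have "eventually (\<lambda>\<eta>::real. \<eta> < e) (at_right 0)"
    using e by (auto simp: eventually_at_right_field)
  ultimately have "\<forall>\<^sub>F (\<epsilon>, \<eta>) in at (0, 0) within {0..} \<times> {0<..}.
      0 \<le> \<epsilon> \<and> 0 < \<eta> \<and> \<epsilon> * (- ln \<epsilon>) powr p < e \<and> \<eta> < e"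
    by (intro eventually_noise_levels) (use e in auto)
  then show "\<forall>\<^sub>F z in at (0, 0) within {0..} \<times> {0<..}. dist (case z of (\<epsilon>, \<eta>) \<Rightarrow> alpha_choice t p \<epsilon> \<eta>) 0 < e"
  proof eventually_elim
    case (elim z)
    obtain \<epsilon> \<eta> where z: "z = (\<epsilon>, \<eta>)" by (cases z)
    have "\<eta> * exp (- (pi\<^sup>2 / (16 * \<eta>\<^sup>2)) * t) \<le> \<eta>"
      using elim t by (simp add: z mult_left_le)
    moreover have "0 < \<eta> * exp (- (pi\<^sup>2 / (16 * \<eta>\<^sup>2)) * t)"
      using elim by (simp add: z)
    ultimately show ?case
      using elim by (auto simp: z alpha_choice_def)
  qed
qed

section \<open>Rates attained by the explicit parameter\<close>

context
  fixes t p Ce \<epsilon> \<eta> :: real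
  assumes t: "0 < t" and p: "0 < p" and Ce: "0 < Ce"
    and \<epsilon>: "0 \<le> \<epsilon>" "small_eps p Ce \<epsilon>" and \<eta>: "0 < \<eta>" "small_eta t p Ce \<eta>"
begin

private definition a where "a = \<eta> * exp (- (pi\<^sup>2 / (16 * \<eta>\<^sup>2)) * t)"
private definition b where "b = \<epsilon> * (- ln \<epsilon>) powr p"
private definition \<alpha> where "\<alpha> = alpha_choice t p \<epsilon> \<eta>"

private lemma \<alpha>_eq: "\<alpha> = max a b"
  by (simp add: \<alpha>_def alpha_choice_def a_def b_def)

private lemma a_bounds: "0 < a" "a < 1"
proof -
  show "0 < a" using \<eta> by (simp add: a_def)
  have "a \<le> \<eta> * 1"
    unfolding a_def using \<eta>(1) t by (intro mult_left_mono) auto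
  then show "a < 1" using \<eta>(2) by (simp add: small_eta_def)
qed

private lemma b_bounds: "0 < \<epsilon> \<Longrightarrow> 0 < b" "b < 1"
  using \<epsilon> by (auto simp: small_eps_def b_def)

lemma alpha_choice_bounds: "0 < alpha_choice t p \<epsilon> \<eta>" "alpha_choice t p \<epsilon> \<eta> < 1"
  using a_bounds b_bounds by (simp_all add: \<alpha>_def [symmetric] \<alpha>_eq)

lemma eps_over_alpha_choice: "\<epsilon> / alpha_choice t p \<epsilon> \<eta> \<le> log_rate p \<epsilon>"
proof (cases "\<epsilon> = 0")
  case True then show ?thesis by (simp add: log_rate_def)
next
  case False
  then have "0 < \<epsilon>" using \<epsilon> by simp
  then have "\<epsilon> / \<alpha> \<le> \<epsilon> / b"
    using b_bounds by (intro divide_left_mono mult_pos_pos) (auto simp: \<alpha>_eq less_max_iff_disj)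
  also have "\<dots> = log_rate p \<epsilon>"
    using False by (simp add: b_def log_rate_def powr_minus field_simps)
  finally show ?thesis by (simp add: \<alpha>_def)
qed

text \<open>Each summand gets half of \<open>Ce\<close>. For the second one the parameter is bounded
  below by \<open>a\<close>: \<open>gam t (2 * \<eta>)\<close> decays with leading exponent 1 / 4,
  \<open>a\<close> only with 1 / 16.\<close>

lemma admissible_alpha_choice: "admissible t Ce \<eta> \<epsilon> (alpha_choice t p \<epsilon> \<eta>)"
proof -
  have "2 * log_rate p \<epsilon> \<le> (Ce / 2)\<^sup>2"
    using \<epsilon> by (auto simp: small_eps_def log_rate_def)
  then have "2 * \<epsilon> / \<alpha> \<le> (Ce / 2)\<^sup>2"
    using eps_over_alpha_choice by (simp add: \<alpha>_def)
  then have "sqrt (2 * \<epsilon> / \<alpha>) \<le> Ce / 2"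
    using Ce by (intro real_le_lsqrt) auto
  moreover have "2 * \<eta> * gam t (2 * \<eta>) / \<alpha> \<le> Ce / 2"
  proof -
    define G where "G = 8 * max 1 (t powr (- 1 / 2)) / (exp (3 * t) - 1)"
    define s where "s = exp (- (pi / (2 * \<eta>) - 3 / 2)\<^sup>2 * t)"
    have G: "0 \<le> G" unfolding G_def using t by (intro divide_nonneg_nonneg) auto
    have "gam t (2 * \<eta>) \<le> G * s"
      using gam_le [OF t \<eta>(1)] \<eta>(2) by (simp add: small_eta_def G_def s_def)
    then have "2 * \<eta> * gam t (2 * \<eta>) / \<alpha> \<le> 2 * \<eta> * (G * s) / \<alpha>"
      using \<eta>(1) alpha_choice_bounds by (intro divide_right_mono mult_left_mono) (auto simp: \<alpha>_def)
    also have "\<dots> \<le> 2 * \<eta> * (G * s) / a"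
      using a_bounds \<eta>(1) G by (intro divide_left_mono mult_pos_pos) (auto simp: \<alpha>_eq s_def less_max_iff_disj)
    also have "\<dots> = 2 * G * (s * exp (pi\<^sup>2 / (16 * \<eta>\<^sup>2) * t))"
      using \<eta>(1) by (simp add: a_def exp_minus field_simps)
    also have "\<dots> \<le> Ce / 2"
      using \<eta>(2) unfolding s_def G_def small_eta_def exp_add [symmetric] by blast
    finally show ?thesis .
  qed
  ultimately show ?thesis
    by (simp add: admissible_def \<alpha>_def)
qed

text \<open>Since \<eta> is at most 1, the factor \<eta> in \<open>a\<close> only increases
  \<open>- ln a\<close>, so the exponential alone determines the rate.\<close>

private lemma log_rate_a: "log_rate p a \<le> (pi\<^sup>2 * t / 16) powr - p * \<eta> powr (2 * p)"
proof -
  have "ln a = ln \<eta> - pi\<^sup>2 / (16 * \<eta>\<^sup>2) * t"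
    using \<eta>(1) by (simp add: a_def ln_mult)
  moreover have "ln \<eta> \<le> 0" using \<eta> by (simp add: small_eta_def)
  ultimately have "pi\<^sup>2 * t / 16 / \<eta>\<^sup>2 \<le> - ln a" by simp
  then have "(- ln a) powr - p \<le> (pi\<^sup>2 * t / 16 / \<eta>\<^sup>2) powr - p"
    using \<eta>(1) t p by (intro powr_mono2') auto
  also have "\<dots> = (pi\<^sup>2 * t / 16) powr - p * (\<eta> powr 2) powr p"
    using \<eta>(1) t by (subst powr_minus_quotient) auto
  finally show ?thesis
    using a_bounds(1) by (simp add: log_rate_def powr_powr)
qed

text \<open>The logarithmic factor in \<open>b\<close> changes \<open>- ln \<epsilon>\<close> by
  lower order; allowing it to lose half costs \<open>2 powr p\<close>.\<close>

private lemma log_rate_b: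
  assumes "0 < \<epsilon>" shows "log_rate p b \<le> 2 powr p * log_rate p \<epsilon>"
proof -
  have "- ln \<epsilon> / 2 \<le> - ln b" "0 < - ln \<epsilon>"
    using assms \<epsilon>(2) by (auto simp: small_eps_def b_def)
  then have "(- ln b) powr - p \<le> (- ln \<epsilon> / 2) powr - p"
    using p by (intro powr_mono2') auto
  also have "\<dots> = 2 powr p * (- ln \<epsilon>) powr - p"
    using \<open>0 < - ln \<epsilon>\<close> by (subst powr_minus_quotient) auto
  finally show ?thesis
    using b_bounds(1) [OF assms] assms by (simp add: log_rate_def)
qed

lemma log_rate_alpha_choice:
  "log_rate p (alpha_choice t p \<epsilon> \<eta>)
    \<le> (pi\<^sup>2 * t / 16) powr - p * \<eta> powr (2 * p) + 2 powr p * log_rate p \<epsilon>"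
proof (cases "b \<le> a")
  case True
  then show ?thesis
    using log_rate_a log_rate_nonneg [of p \<epsilon>] by (simp add: \<alpha>_def [symmetric] \<alpha>_eq add_increasing2)
next
  case False
  then have "0 < \<epsilon>" using a_bounds \<epsilon>(1) unfolding b_def by (cases "\<epsilon> = 0") auto
  then show ?thesis
    using False log_rate_b by (simp add: \<alpha>_def [symmetric] \<alpha>_eq add_increasing)
qed

text \<open>Multiplying the parameter by the sum of both rates would create mixed terms such as
  \<open>b * \<eta> powr (2 * p)\<close>. The case distinction pairs each entry of the maximum with
  its own rate.\<close>

lemma alpha_choice_mult_log_rate:
  "alpha_choice t p \<epsilon> \<eta> * log_rate p (alpha_choice t p \<epsilon> \<eta>)
    \<le> (pi\<^sup>2 * t / 16) powr - p * (exp (- (pi\<^sup>2 / (16 * \<eta>\<^sup>2)) * t) * \<eta> powr (2 * p + 1)) + 2 powr p * \<epsilon>"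
proof (cases "b \<le> a")
  case True
  have "\<alpha> * log_rate p \<alpha> \<le> a * ((pi\<^sup>2 * t / 16) powr - p * \<eta> powr (2 * p))"
    using True log_rate_a a_bounds by (simp add: \<alpha>_eq mult_left_mono)
  also have "\<dots> = (pi\<^sup>2 * t / 16) powr - p * (exp (- (pi\<^sup>2 / (16 * \<eta>\<^sup>2)) * t) * \<eta> powr (2 * p + 1))"
    using \<eta>(1) by (simp add: a_def powr_add)
  finally show ?thesis
    using \<epsilon>(1) by (simp add: \<alpha>_def add_increasing2)
next
  case False
  then have e: "0 < \<epsilon>" using a_bounds \<epsilon>(1) unfolding b_def by (cases "\<epsilon> = 0") auto
  then have "\<alpha> * log_rate p \<alpha> \<le> b * (2 powr p * log_rate p \<epsilon>)"
    using False log_rate_b b_bounds by (simp add: \<alpha>_eq mult_left_mono)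
  \<comment> \<open>The powers of \<open>- ln \<epsilon>\<close> cancel:
    \<open>b * log_rate p \<epsilon>\<close> is exactly \<epsilon>.\<close>
  also have "\<dots> = 2 powr p * \<epsilon>"
    using e \<epsilon>(2) by (simp add: b_def log_rate_def powr_minus small_eps_def)
  finally show ?thesis
    using \<eta>(1) by (simp add: \<alpha>_def add_increasing)
qed

private definition z where "z = exp (- (27 * pi\<^sup>2 / (200 * \<eta>\<^sup>2)) * t)"

private lemma z_over_a: "\<eta>\<^sup>2 / a\<^sup>2 * z \<le> \<eta> powr (2 * p)"
proof -
  have "\<eta>\<^sup>2 / a\<^sup>2 * z = exp (2 * (pi\<^sup>2 / (16 * \<eta>\<^sup>2) * t)) * z"
    using \<eta>(1) unfolding exp_double by (simp add: a_def exp_minus power_mult_distrib field_simps)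
  \<comment> \<open>Dividing by \<open>a\<^sup>2\<close> uses up 25 / 200 of the exponent 27 /
    200.\<close>
  also have "\<dots> = exp (- (pi\<^sup>2 / (100 * \<eta>\<^sup>2)) * t)"
    unfolding z_def exp_add [symmetric] using \<eta>(1) by (simp add: field_simps)
  also have "\<dots> \<le> \<eta> powr (2 * p)"
    using \<eta>(2) by (simp add: small_eta_def)
  finally show ?thesis .
qed

lemma tail_over_alpha_choice_sq:
  "\<eta>\<^sup>2 / (alpha_choice t p \<epsilon> \<eta>)\<^sup>2 * exp (- (27 * pi\<^sup>2 / (200 * \<eta>\<^sup>2)) * t) \<le> \<eta> powr (2 * p)"
proof -
  have "\<eta>\<^sup>2 / \<alpha>\<^sup>2 * z \<le> \<eta>\<^sup>2 / a\<^sup>2 * z"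
    using a_bounds by (intro mult_right_mono divide_left_mono power_mono mult_pos_pos)
      (auto simp: \<alpha>_eq z_def less_max_iff_disj)
  with z_over_a show ?thesis by (simp add: \<alpha>_def z_def)
qed

text \<open>Only one division by the parameter occurs here, so the bound for the squared quotient
  gains a factor \<open>a\<close>, which supplies the exponential and the additional power of
  \<eta>.\<close>

lemma tail_over_alpha_choice:
  "\<eta>\<^sup>2 / alpha_choice t p \<epsilon> \<eta> * exp (- (27 * pi\<^sup>2 / (200 * \<eta>\<^sup>2)) * t)
    \<le> exp (- (pi\<^sup>2 / (16 * \<eta>\<^sup>2)) * t) * \<eta> powr (2 * p + 1)"
proof -
  have "\<eta>\<^sup>2 / \<alpha> * z \<le> \<eta>\<^sup>2 / a * z"
    using a_bounds by (intro mult_right_mono divide_left_mono mult_pos_pos)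
      (auto simp: \<alpha>_eq z_def less_max_iff_disj)
  also have "\<dots> = a * (\<eta>\<^sup>2 / a\<^sup>2 * z)"
    using a_bounds by (simp add: power2_eq_square)
  also have "\<dots> \<le> a * \<eta> powr (2 * p)"
    using z_over_a a_bounds by (intro mult_left_mono) auto
  also have "\<dots> = exp (- (pi\<^sup>2 / (16 * \<eta>\<^sup>2)) * t) * \<eta> powr (2 * p + 1)"
    using \<eta>(1) by (simp add: a_def powr_add)
  finally show ?thesis by (simp add: \<alpha>_def z_def)
qed

end

section \<open>The general estimate and the rates for the chosen parameter\<close>

theorem theorem4p2:
  fixes t p Ce :: real and fdag :: "real \<Rightarrow> complex"
  assumes "0 < t" and "0 < p" and "0 < Ce" and "fdag \<in> sobolev p"
  shows
    "(\<exists>\<eta>0>0. \<exists>C>0. \<exists>r1 r2 :: real \<times> real \<times> real \<Rightarrow> real.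
        r1 \<in> o[at (0, 0, 0) within {0<..} \<times> {0..} \<times> {0<..}](\<lambda>_. 1) \<and>
        r2 \<in> o[at (0, 0, 0) within {0<..} \<times> {0..} \<times> {0<..}](\<lambda>_. 1) \<and>
        (\<forall>\<eta> \<epsilon> \<alpha>. 0 < \<eta> \<and> \<eta> \<le> \<eta>0 \<and> 0 \<le> \<epsilon> \<and> 0 < \<alpha> \<and> \<alpha> < 1 \<and> admissible t Ce \<eta> \<epsilon> \<alpha> \<longrightarrow>
          (\<forall>\<xi>\<in>L1. \<forall>f. impulsive_noise \<epsilon> \<eta> \<xi> \<and>
              tikhonov_minimizer t \<alpha> (\<lambda>x. heat_op t fdag x + \<xi> x) f \<longrightarrow>
            (L2_norm (\<lambda>x. f x - fdag x))\<^sup>2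
              \<le> C * (\<epsilon> / \<alpha> + \<eta>\<^sup>2 / \<alpha>\<^sup>2 * exp (- (pi\<^sup>2 / (8 * \<eta>\<^sup>2)) * t) + log_rate p \<alpha>)
                  * (1 + r1 (\<eta>, \<epsilon>, \<alpha>)) \<and>
            L1_norm (\<lambda>x. heat_op t f x - heat_op t fdag x)
              \<le> C * (\<epsilon> + \<eta>\<^sup>2 / \<alpha> * exp (- (pi\<^sup>2 / (8 * \<eta>\<^sup>2)) * t) + \<alpha> * log_rate p \<alpha>)
                  * (1 + r2 (\<eta>, \<epsilon>, \<alpha>)))))
     \<and>
     (\<exists>(\<alpha>bar :: real \<Rightarrow> real \<Rightarrow> real) K.
        (\<forall>\<epsilon>\<ge>0. \<forall>\<eta>>0. 0 < \<alpha>bar \<epsilon> \<eta>) \<and>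
        ((\<lambda>(\<epsilon>, \<eta>). \<alpha>bar \<epsilon> \<eta>) \<longlongrightarrow> 0) (at (0, 0) within {0..} \<times> {0<..}) \<and>
        (\<forall>\<^sub>F (\<epsilon>, \<eta>) in at (0, 0) within {0..} \<times> {0<..}.
          admissible t Ce \<eta> \<epsilon> (\<alpha>bar \<epsilon> \<eta>) \<and>
          (\<forall>\<xi>\<in>L1. \<forall>f. impulsive_noise \<epsilon> \<eta> \<xi> \<and>
              tikhonov_minimizer t (\<alpha>bar \<epsilon> \<eta>) (\<lambda>x. heat_op t fdag x + \<xi> x) f \<longrightarrow>
            (L2_norm (\<lambda>x. f x - fdag x))\<^sup>2 \<le> K * max (log_rate p \<epsilon>) (\<eta> powr (2 * p)) \<and>
            L1_norm (\<lambda>x. heat_op t f x - heat_op t fdag x)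
              \<le> K * max \<epsilon> (exp (- (pi\<^sup>2 / (16 * \<eta>\<^sup>2)) * t) * \<eta> powr (2 * p + 1)))))"
    (is "?general \<and> ?choice")
proof -
  obtain K where K: "0 < K" and energy: "\<And>\<eta> \<epsilon> \<alpha> \<xi> f. 0 < \<eta> \<Longrightarrow> \<eta> \<le> 1 / 5 \<Longrightarrow> 0 \<le> \<epsilon> \<Longrightarrow> 0 < \<alpha> \<Longrightarrow> \<alpha> < 1 \<Longrightarrow>
      \<xi> \<in> L1 \<Longrightarrow> impulsive_noise \<epsilon> \<eta> \<xi> \<Longrightarrow> tikhonov_minimizer t \<alpha> (\<lambda>x. heat_op t fdag x + \<xi> x) f \<Longrightarrow>
    (L2_norm (\<lambda>x. f x - fdag x))\<^sup>2 + L1_norm (\<lambda>x. heat_op t f x - heat_op t fdag x) / \<alpha> \<le>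
      K * (\<epsilon> / \<alpha> + \<eta>\<^sup>2 / \<alpha>\<^sup>2 * exp (- (27 * pi\<^sup>2 / (200 * \<eta>\<^sup>2)) * t) + log_rate p \<alpha>)"
    using energy_estimate [OF assms(1,2,4)] by blast
  \<comment> \<open>The exponential is replaced by an arbitrary upper bound \<open>e\<close>, so
    that one argument serves the general estimate with the weaker exponent 1 / 8 and the parameter
    choice with the full 27 / 200.\<close>
  have bounds: "(L2_norm (\<lambda>x. f x - fdag x))\<^sup>2 \<le> K * (\<epsilon> / \<alpha> + \<eta>\<^sup>2 / \<alpha>\<^sup>2 * e + log_rate p \<alpha>)"
    "L1_norm (\<lambda>x. heat_op t f x - heat_op t fdag x) \<le> K * (\<epsilon> + \<eta>\<^sup>2 / \<alpha> * e + \<alpha> * log_rate p \<alpha>)"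
    if "0 < \<eta>" "\<eta> \<le> 1 / 5" "0 \<le> \<epsilon>" and \<alpha>: "0 < \<alpha>" "\<alpha> < 1" and "\<xi> \<in> L1" "impulsive_noise \<epsilon> \<eta> \<xi>"
      "tikhonov_minimizer t \<alpha> (\<lambda>x. heat_op t fdag x + \<xi> x) f"
      and e: "exp (- (27 * pi\<^sup>2 / (200 * \<eta>\<^sup>2)) * t) \<le> e" for \<eta> \<epsilon> \<alpha> \<xi> f e
  proof -
    let ?L = "L1_norm (\<lambda>x. heat_op t f x - heat_op t fdag x)"
    have "\<eta>\<^sup>2 / \<alpha>\<^sup>2 * exp (- (27 * pi\<^sup>2 / (200 * \<eta>\<^sup>2)) * t) \<le> \<eta>\<^sup>2 / \<alpha>\<^sup>2 * e"
      using e by (intro mult_left_mono) auto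
    then have "K * (\<epsilon> / \<alpha> + \<eta>\<^sup>2 / \<alpha>\<^sup>2 * exp (- (27 * pi\<^sup>2 / (200 * \<eta>\<^sup>2)) * t) + log_rate p \<alpha>)
        \<le> K * (\<epsilon> / \<alpha> + \<eta>\<^sup>2 / \<alpha>\<^sup>2 * e + log_rate p \<alpha>)"
      using K by (intro mult_left_mono) auto
    then have *: "(L2_norm (\<lambda>x. f x - fdag x))\<^sup>2 + ?L / \<alpha> \<le> K * (\<epsilon> / \<alpha> + \<eta>\<^sup>2 / \<alpha>\<^sup>2 * e + log_rate p \<alpha>)"
      using energy [OF that(1-8)] by linarith
    moreover have "0 \<le> ?L / \<alpha>" using \<alpha> by simp
    ultimately show "(L2_norm (\<lambda>x. f x - fdag x))\<^sup>2 \<le> K * (\<epsilon> / \<alpha> + \<eta>\<^sup>2 / \<alpha>\<^sup>2 * e + log_rate p \<alpha>)"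
      by linarith
    have "?L / \<alpha> \<le> K * (\<epsilon> / \<alpha> + \<eta>\<^sup>2 / \<alpha>\<^sup>2 * e + log_rate p \<alpha>)"
      using * zero_le_power2 [of "L2_norm (\<lambda>x. f x - fdag x)"] by linarith
    then have "?L \<le> \<alpha> * (K * (\<epsilon> / \<alpha> + \<eta>\<^sup>2 / \<alpha>\<^sup>2 * e + log_rate p \<alpha>))"
      using \<alpha> by (simp add: pos_divide_le_eq mult.commute)
    also have "\<dots> = K * (\<epsilon> + \<eta>\<^sup>2 / \<alpha> * e + \<alpha> * log_rate p \<alpha>)"
      using \<alpha> by (simp add: power2_eq_square field_simps)
    finally show "?L \<le> K * (\<epsilon> + \<eta>\<^sup>2 / \<alpha> * e + \<alpha> * log_rate p \<alpha>)" .
  qed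
  have ?general
  proof (intro exI conjI allI impI ballI; (elim conjE)?)
    show "(0::real) < 1 / 5" "0 < K" using K by auto
    show "(\<lambda>_. 0) \<in> o[at (0, 0, 0) within {0<..} \<times> {0..} \<times> {0<..}](\<lambda>_::real \<times> real \<times> real. 1 :: real)"
      "(\<lambda>_. 0) \<in> o[at (0, 0, 0) within {0<..} \<times> {0..} \<times> {0<..}](\<lambda>_::real \<times> real \<times> real. 1 :: real)"
      by simp_all
    fix \<eta> \<epsilon> \<alpha> :: real and \<xi> f
    assume *: "0 < \<eta>" "\<eta> \<le> 1 / 5" "0 \<le> \<epsilon>" "0 < \<alpha>" "\<alpha> < 1" "\<xi> \<in> L1" "impulsive_noise \<epsilon> \<eta> \<xi>"
      "tikhonov_minimizer t \<alpha> (\<lambda>x. heat_op t fdag x + \<xi> x) f"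
    \<comment> \<open>This is 25 / 200 < 27 / 200.\<close>
    have "exp (- (27 * pi\<^sup>2 / (200 * \<eta>\<^sup>2)) * t) \<le> exp (- (pi\<^sup>2 / (8 * \<eta>\<^sup>2)) * t)"
      using assms(1) *(1) by (simp add: field_simps)
    from bounds [OF * this]
    show "(L2_norm (\<lambda>x. f x - fdag x))\<^sup>2
              \<le> K * (\<epsilon> / \<alpha> + \<eta>\<^sup>2 / \<alpha>\<^sup>2 * exp (- (pi\<^sup>2 / (8 * \<eta>\<^sup>2)) * t) + log_rate p \<alpha>) * (1 + 0)"
      "L1_norm (\<lambda>x. heat_op t f x - heat_op t fdag x)
              \<le> K * (\<epsilon> + \<eta>\<^sup>2 / \<alpha> * exp (- (pi\<^sup>2 / (8 * \<eta>\<^sup>2)) * t) + \<alpha> * log_rate p \<alpha>) * (1 + 0)"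
      by simp_all
  qed
  moreover have ?choice
  proof -
    define C where "C = (pi\<^sup>2 * t / 16) powr - p + 2 powr p + 2"
    define D where "D = (pi\<^sup>2 * t / 16) powr - p"
    have D: "0 \<le> D" by (simp add: D_def)
    \<comment> \<open>Both rates have this shape: \<open>u\<close> is the contribution of
      \<epsilon>, \<open>v\<close> that of \<eta>, and the bracket bounds the logarithmic term of
      the parameter, multiplied by the parameter in the case of the data error.\<close>
    have max_bound: "K * (u + v + (D * v + 2 powr p * u)) \<le> K * C * max u v" if "0 \<le> u" "0 \<le> v" for u v
    proof -
      have "u + v + (D * v + 2 powr p * u) \<le> max u v + max u v + (D * max u v + 2 powr p * max u v)"
        using D by (intro add_mono mult_left_mono) auto
      also have "\<dots> = C * max u v"
        by (simp add: C_def D_def distrib_right)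
      finally show ?thesis using K by (simp add: mult.assoc mult_left_mono)
    qed
    have "\<forall>\<^sub>F (\<epsilon>, \<eta>) in at (0, 0) within {0..} \<times> {0<..}.
        0 \<le> \<epsilon> \<and> 0 < \<eta> \<and> small_eps p Ce \<epsilon> \<and> small_eta t p Ce \<eta>"
      using assms by (intro eventually_noise_levels eventually_small_eps eventually_small_eta)
        (auto simp: small_eps_def)
    then have "\<forall>\<^sub>F (\<epsilon>, \<eta>) in at (0, 0) within {0..} \<times> {0<..}.
          admissible t Ce \<eta> \<epsilon> (alpha_choice t p \<epsilon> \<eta>) \<and>
          (\<forall>\<xi>\<in>L1. \<forall>f. impulsive_noise \<epsilon> \<eta> \<xi> \<and>
              tikhonov_minimizer t (alpha_choice t p \<epsilon> \<eta>) (\<lambda>x. heat_op t fdag x + \<xi> x) f \<longrightarrow>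
            (L2_norm (\<lambda>x. f x - fdag x))\<^sup>2 \<le> K * C * max (log_rate p \<epsilon>) (\<eta> powr (2 * p)) \<and>
            L1_norm (\<lambda>x. heat_op t f x - heat_op t fdag x)
              \<le> K * C * max \<epsilon> (exp (- (pi\<^sup>2 / (16 * \<eta>\<^sup>2)) * t) * \<eta> powr (2 * p + 1)))"
    proof (rule eventually_mono, clarify, intro conjI ballI allI impI; (elim conjE)?)
      fix \<epsilon> \<eta> :: real
      assume \<epsilon>: "0 \<le> \<epsilon>" "small_eps p Ce \<epsilon>" and \<eta>: "0 < \<eta>" "small_eta t p Ce \<eta>"
      note hyps = assms(1-3) \<epsilon> \<eta>
      show "admissible t Ce \<eta> \<epsilon> (alpha_choice t p \<epsilon> \<eta>)"
        using hyps by (rule admissible_alpha_choice)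
      fix \<xi> f
      assume noise: "\<xi> \<in> L1" "impulsive_noise \<epsilon> \<eta> \<xi>"
        "tikhonov_minimizer t (alpha_choice t p \<epsilon> \<eta>) (\<lambda>x. heat_op t fdag x + \<xi> x) f"
      have \<eta>5: "\<eta> \<le> 1 / 5" using \<eta> by (simp add: small_eta_def)
      note b = bounds [OF \<eta>(1) \<eta>5 \<epsilon>(1) alpha_choice_bounds [OF hyps] noise order_refl]
      show "(L2_norm (\<lambda>x. f x - fdag x))\<^sup>2 \<le> K * C * max (log_rate p \<epsilon>) (\<eta> powr (2 * p))"
        using K by (intro order_trans [OF b(1)] order_trans [OF mult_left_mono max_bound] add_mono
            eps_over_alpha_choice [OF hyps] tail_over_alpha_choice_sq [OF hyps]
            log_rate_alpha_choice [OF hyps, folded D_def] log_rate_nonneg) auto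
      show "L1_norm (\<lambda>x. heat_op t f x - heat_op t fdag x)
              \<le> K * C * max \<epsilon> (exp (- (pi\<^sup>2 / (16 * \<eta>\<^sup>2)) * t) * \<eta> powr (2 * p + 1))"
        using K \<epsilon>(1) by (intro order_trans [OF b(2)] order_trans [OF mult_left_mono max_bound] add_mono
            tail_over_alpha_choice [OF hyps] order_refl
            alpha_choice_mult_log_rate [OF hyps, folded D_def]) auto
    qed
    moreover have "\<forall>\<epsilon>\<ge>0. \<forall>\<eta>>0. 0 < alpha_choice t p \<epsilon> \<eta>"
      by (simp add: alpha_choice_def less_max_iff_disj)
    ultimately show ?thesis
      using alpha_choice_tendsto [OF assms(1,2)]
      by (intro exI [of _ "alpha_choice t p"] exI [of _ "K * C"] conjI)
  qed
  ultimately show ?thesis ..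
qed

end
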